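(* Let $X\subset\mathbb{R}^n$ be a non-empty closed semialgebraic set, let $a\in\mathbb{R}^n$, and let $K$ be a compact neighbourhood of $a$. Then there exist constants $C,\alpha>0$ such that $$\mathrm{dist}_H(m(x),m(a))\ge C\, d\big(x,\{y\in\mathbb{R}^n: m(a)\subset m(y)\}\big)^{\alpha},\qquad x\in K.$$
   Context: For a non-empty closed set $X\subset\mathbb{R}^n$ and $x\in\mathbb{R}^n$, $m(x)=\{y\in X:\|y-x\|=d(x,X)\}$ is the (non-empty compact) set of points of $X$ closest to $x$, with $\|\cdot\|$ the Euclidean norm and $d(x,S)$ the Euclidean distance from $x$ to $S$. For non-empty compact sets $A,B$, $\mathrm{dist}_H(A,B)=\max\{\max_{x\in A}d(x,B),\max_{x\in B}d(x,A)\}$. *)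

theory Defs
  imports "HOL-Analysis.Analysis"
begin

definition basic_semialgebraic :: "(real ^ 'n) set \<Rightarrow> bool" where
  "basic_semialgebraic B \<longleftrightarrow>
     (\<exists>P Q. finite P \<and> finite Q \<and>
        (\<forall>f\<in>P \<union> Q. real_polynomial_function f) \<and>
        B = {x. (\<forall>f\<in>P. f x = 0) \<and> (\<forall>g\<in>Q. g x > 0)})"

definition semialgebraic :: "(real ^ 'n) set \<Rightarrow> bool" where
  "semialgebraic S \<longleftrightarrow>
     (\<exists>F. finite F \<and> (\<forall>B\<in>F. basic_semialgebraic B) \<and> S = \<Union>F)"

definition nearest_points :: "(real ^ 'n) set \<Rightarrow> real ^ 'n \<Rightarrow> (real ^ 'n) set" where
  "nearest_points X x = {y \<in> X. norm (y - x) = infdist x X}"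

(* Meant for non-empty compact A and B only, where both suprema are attained. *)
definition hausdorff_dist :: "(real ^ 'n) set \<Rightarrow> (real ^ 'n) set \<Rightarrow> real" where
  "hausdorff_dist A B = max (SUP x\<in>A. infdist x B) (SUP x\<in>B. infdist x A)"

end

theory Submission
  imports Defs
begin

text \<open>
  Let \<open>M = m(a)\<close> and \<open>V = {y. M \<subseteq> m(y)}\<close>, an intersection of Voronoi cells. If \<open>dist\<^sub>H(m(x), M) = h\<close>,
  then \<open>|x - b| \<le> |x - z| + h\<close> for all \<open>b \<in> M\<close> and \<open>z \<in> X\<close>, so \<open>|x - b|\<^sup>2 \<le> |x - z|\<^sup>2 + L h\<close> on \<open>K\<close>.
  For \<open>h = 0\<close> these inequalities define \<open>V\<close>, and it remains to bound \<open>d(x, V)\<close> by a power of the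
  defect \<open>t = L h\<close>, a Lojasiewicz inequality. Let \<open>s(t)\<close> be the supremum of \<open>d(x, V)\<^sup>2\<close> over the
  points \<open>x\<close> of a ball with defect at most \<open>t\<close>. By compactness \<open>s(t)\<close> tends to 0 with \<open>t\<close>, and by
  quantifier elimination \<open>s(t)\<close> is a root of one of finitely many nonzero polynomials in \<open>(t, s)\<close>,
  which forces \<open>s(t)\<^sup>N \<le> C t\<close>.

  Quantifier elimination is proved in back-and-forth form: given finitely many polynomials in \<open>(e, t)\<close>
  there are finitely many polynomials in \<open>e\<close> such that, whenever these have equal signs at \<open>e\<close> and
  \<open>e'\<close>, every sign vector realised by some \<open>t\<close> over \<open>e\<close> is realised by some \<open>t'\<close> over \<open>e'\<close>.
  For a family closed under derivatives, Thom's lemma makes each sign condition convex and hence the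
  correspondence of sign vectors order preserving, so no homeomorphism of the line has to be built.
\<close>

section \<open>Matching sign vectors of two specialisations\<close>

lemma sgn_mono_real: "x \<le> y \<Longrightarrow> sgn x \<le> sgn (y::real)"
  by (auto simp: sgn_real_def)

lemma poly_mono_Icc:
  fixes f :: "real poly"
  assumes "s \<le> t" "\<And>x. s < x \<Longrightarrow> x < t \<Longrightarrow> 0 \<le> poly (pderiv f) x"
  shows "poly f s \<le> poly f t"
proof (cases "s < t")
  case True
  then obtain x where "s < x" "x < t" "poly f t - poly f s = (t - s) * poly (pderiv f) x"
    using poly_MVT by blast
  with assms(2)[of x] show ?thesis
    by (smt (verit) mult_nonneg_nonneg)
qed (use assms in auto)

lemma poly_antimono_Icc:
  fixes f :: "real poly"
  assumes "s \<le> t" "\<And>x. s < x \<Longrightarrow> x < t \<Longrightarrow> poly (pderiv f) x \<le> 0"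
  shows "poly f t \<le> poly f s"
  using poly_mono_Icc[of s t "- f"] assms by (simp add: pderiv_minus)

lemma sgn_poly_constant_on_interval:
  fixes f :: "real poly"
  assumes "s \<le> t" "\<And>x. s \<le> x \<Longrightarrow> x \<le> t \<Longrightarrow> poly f x \<noteq> 0"
  shows "sgn (poly f s) = sgn (poly f t)"
proof (rule ccontr)
  assume ne: "sgn (poly f s) \<noteq> sgn (poly f t)"
  then have "s < t" using assms(1) by (cases "s = t") auto
  moreover have "poly f s * poly f t < 0"
    using ne assms(2)[of s] assms(2)[of t] assms(1)
    by (auto simp: sgn_real_def mult_less_0_iff split: if_splits)
  ultimately show False
    using poly_IVT[of s t f] assms(2) by fastforce
qed

lemma degree_0_poly_eq:
  "degree f \<le> 0 \<Longrightarrow> poly f x = coeff f 0"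
  by (auto elim: degree_eq_zeroE)

text \<open>The number attached to a polynomial is only a bound on its degree. It drops under
  differentiation even if the polynomial degenerates, so it can serve as the measure for
  induction.\<close>

definition deriv_closed :: "(nat \<times> real poly) set \<Rightarrow> bool" where
  "deriv_closed S \<longleftrightarrow>
     (\<forall>d f. (d, f) \<in> S \<longrightarrow> degree f \<le> d \<and> (d > 0 \<longrightarrow> (d - 1, pderiv f) \<in> S))"

text \<open>Induction on the formal degree: the derivative has constant sign on the interval, so
  \<open>f\<close> is monotone there and its sign at \<open>r\<close> is squeezed between two equal
  signs. The bound \<open>n\<close> allows the lemma to be applied to the low-degree part of a
  family alone.\<close>

lemma thom_sign_condition_convex:
  assumes S: "deriv_closed S"
    and same: "\<And>d f. (d, f) \<in> S \<Longrightarrow> d \<le> n \<Longrightarrow> sgn (poly f s) = sgn (poly f t)"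
    and r: "s \<le> r" "r \<le> t"
    and f: "(d, f) \<in> S" "d \<le> n"
  shows "sgn (poly f r) = sgn (poly f s)"
  using r f
proof (induction d arbitrary: f r)
  case 0
  then have "degree f \<le> 0" using S by (auto simp: deriv_closed_def)
  then show ?case by (simp add: degree_0_poly_eq)
next
  case (Suc d)
  have f': "(d, pderiv f) \<in> S"
    using S Suc.prems by (force simp: deriv_closed_def)
  have der: "sgn (poly (pderiv f) x) = sgn (poly (pderiv f) s)" if "s \<le> x" "x \<le> t" for x
    using Suc.IH[OF that f'] Suc.prems by simp
  have eq: "sgn (poly f s) = sgn (poly f t)"
    using same Suc.prems by blast
  show ?case
  proof (cases "0 \<le> poly (pderiv f) s")
    case True
    have nn: "0 \<le> poly (pderiv f) x" if "s \<le> x" "x \<le> t" for x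
      using der[OF that] True by (auto simp: sgn_real_def split: if_splits)
    have "poly f s \<le> poly f r" "poly f r \<le> poly f t"
      using Suc.prems nn by (auto intro!: poly_mono_Icc)
    then show ?thesis
      using eq sgn_mono_real[of "poly f s" "poly f r"] sgn_mono_real[of "poly f r" "poly f t"]
      by linarith
  next
    case False
    have np: "poly (pderiv f) x \<le> 0" if "s \<le> x" "x \<le> t" for x
      using der[OF that] False by (auto simp: sgn_real_def split: if_splits)
    have "poly f r \<le> poly f s" "poly f t \<le> poly f r"
      using Suc.prems np by (auto intro!: poly_antimono_Icc)
    then show ?thesis
      using eq sgn_mono_real[of "poly f r" "poly f s"] sgn_mono_real[of "poly f t" "poly f r"]
      by linarith
  qed
qed

text \<open>A triple \<open>(d, f, g)\<close> stands for a polynomial of formal degree \<open>d\<close> over a parameter space,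
  specialised to \<open>f\<close> and \<open>g\<close> at two parameter values; the true degrees may be smaller.\<close>

definition matched :: "(nat \<times> real poly \<times> real poly) set \<Rightarrow> bool" where
  "matched S \<longleftrightarrow> finite S \<and>
     (\<forall>d f g. (d, f, g) \<in> S \<longrightarrow> degree f \<le> d \<and> degree g \<le> d \<and>
        (\<forall>i. sgn (coeff f i) = sgn (coeff g i)) \<and>
        (d > 0 \<longrightarrow> (d - 1, pderiv f, pderiv g) \<in> S))"

text \<open>Remainders come from pseudo-division, which avoids dividing by a leading coefficient;
  both specialisations share the exponent \<open>k\<close>, so the multipliers have equal signs. A
  formal leading coefficient may vanish, and the truncation clause then provides the same polynomial
  with a smaller formal degree.\<close>

definition remainder_closed :: "(nat \<times> real poly \<times> real poly) set \<Rightarrow> bool" where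
  "remainder_closed S \<longleftrightarrow>
     (\<forall>d f g. (d, f, g) \<in> S \<longrightarrow> d > 0 \<longrightarrow>
        (d - 1, f - monom (coeff f d) d, g - monom (coeff g d) d) \<in> S) \<and>
     (\<forall>m p q n f g. (m, p, q) \<in> S \<longrightarrow> (n, f, g) \<in> S \<longrightarrow> 0 < n \<longrightarrow> n \<le> m \<longrightarrow>
        (\<exists>k r r'. (n - 1, r, r') \<in> S \<and> f dvd smult (coeff f n ^ k) p - r \<and>
           g dvd smult (coeff g n ^ k) q - r'))"

definition same_signs :: "(nat \<times> real poly \<times> real poly) set \<Rightarrow> real \<Rightarrow> real \<Rightarrow> bool" where
  "same_signs S t t' \<longleftrightarrow> (\<forall>d f g. (d, f, g) \<in> S \<longrightarrow> sgn (poly f t) = sgn (poly g t'))"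

section \<open>Two symmetries: exchanging the specialisations and reflecting the line\<close>

definition swap_family ::
  "(nat \<times> real poly \<times> real poly) set \<Rightarrow> (nat \<times> real poly \<times> real poly) set" where
  "swap_family S = {(d, f, g). (d, g, f) \<in> S}"

lemma swap_family_iff [simp]: "(d, f, g) \<in> swap_family S \<longleftrightarrow> (d, g, f) \<in> S"
  by (simp add: swap_family_def)

lemma same_signs_swap [simp]: "same_signs (swap_family S) t t' \<longleftrightarrow> same_signs S t' t"
  unfolding same_signs_def swap_family_iff by (auto intro: sym)

lemma matched_swap:
  assumes S: "matched S"
  shows "matched (swap_family S)"
proof -
  have "swap_family S = (\<lambda>(d, f, g). (d, g, f)) ` S"
    by (force simp: swap_family_def)
  then show ?thesis
    using S unfolding matched_def swap_family_iff by simp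
qed

lemma remainder_closed_swap:
  assumes S: "remainder_closed S"
  shows "remainder_closed (swap_family S)"
  unfolding remainder_closed_def swap_family_iff
proof (intro conjI allI impI)
  show "(d - 1, g - monom (coeff g d) d, f - monom (coeff f d) d) \<in> S"
    if "(d, g, f) \<in> S" "d > 0" for d f g
    using S that unfolding remainder_closed_def by blast
  show "\<exists>k r r'. (n - 1, r', r) \<in> S \<and> f dvd smult (coeff f n ^ k) p - r \<and>
      g dvd smult (coeff g n ^ k) q - r'"
    if h: "(m, q, p) \<in> S" "(n, g, f) \<in> S" "0 < n" "n \<le> m" for m p q n f g
  proof -
    have "\<exists>k r r'. (n - 1, r, r') \<in> S \<and> g dvd smult (coeff g n ^ k) q - r \<and>
           f dvd smult (coeff f n ^ k) p - r'"
      using S h unfolding remainder_closed_def by blast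
    then show ?thesis by blast
  qed
qed

text \<open>The factor \<open>(-1) ^ d\<close> absorbs the sign from the chain rule, so that
  reflection at degree \<open>d\<close> followed by a derivative is the derivative followed by
  reflection at degree \<open>d - 1\<close>.\<close>

definition reflect :: "nat \<Rightarrow> real poly \<Rightarrow> real poly" where
  "reflect d f = smult ((-1) ^ d) (pcompose f [:0, -1:])"

definition reflect_family ::
  "(nat \<times> real poly \<times> real poly) set \<Rightarrow> (nat \<times> real poly \<times> real poly) set" where
  "reflect_family S = (\<lambda>(d, f, g). (d, reflect d f, reflect d g)) ` S"

lemma reflect_family_iff:
  "(d, f, g) \<in> reflect_family S \<longleftrightarrow>
     (\<exists>f0 g0. (d, f0, g0) \<in> S \<and> f = reflect d f0 \<and> g = reflect d g0)"
  by (force simp: reflect_family_def)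

lemma poly_reflect: "poly (reflect d f) x = (-1) ^ d * poly f (- x)"
  by (simp add: reflect_def poly_pcompose)

lemma reflect_eq_0_iff [simp]: "reflect d f = 0 \<longleftrightarrow> f = 0"
  by (auto simp: reflect_def pcompose_eq_0_iff)

lemma pderiv_reflect: "d > 0 \<Longrightarrow> pderiv (reflect d f) = reflect (d - 1) (pderiv f)"
  by (cases d) (auto simp: reflect_def pderiv_smult pderiv_minus pderiv_pcompose pderiv_pCons)

lemma sgn_coeff_reflect: "sgn (coeff (reflect d f) i) = (-1) ^ d * (-1) ^ i * sgn (coeff f i)"
  by (simp add: reflect_def coeff_pcompose_linear sgn_mult)

lemma matched_reflect:
  assumes S: "matched S"
  shows "matched (reflect_family S)"
  unfolding matched_def
proof (intro conjI allI impI)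
  show "finite (reflect_family S)" using S by (simp add: matched_def reflect_family_def)
next
  fix d f g assume "(d, f, g) \<in> reflect_family S"
  then obtain f0 g0 where fg: "(d, f0, g0) \<in> S" "f = reflect d f0" "g = reflect d g0"
    by (auto simp: reflect_family_def)
  then have deg: "degree f0 \<le> d" "degree g0 \<le> d"
      "\<And>i. sgn (coeff f0 i) = sgn (coeff g0 i)"
      "d > 0 \<Longrightarrow> (d - 1, pderiv f0, pderiv g0) \<in> S"
    using S by (auto simp: matched_def)
  show "degree f \<le> d" "degree g \<le> d"
    using deg fg by (auto simp: reflect_def degree_pcompose)
  show "sgn (coeff f i) = sgn (coeff g i)" for i
    using deg fg by (simp add: sgn_coeff_reflect)
  assume "d > 0"
  then show "(d - 1, pderiv f, pderiv g) \<in> reflect_family S"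
    using deg(4) unfolding reflect_family_def fg(2,3) by (force simp: pderiv_reflect)
qed

lemma same_signs_reflect:
  "same_signs (reflect_family S) t t' \<longleftrightarrow> same_signs S (- t) (- t')"
proof -
  have "same_signs (reflect_family S) t t' \<longleftrightarrow>
      (\<forall>d f g. (d, f, g) \<in> S \<longrightarrow> sgn (poly (reflect d f) t) = sgn (poly (reflect d g) t'))"
    unfolding same_signs_def reflect_family_iff by blast
  also have "\<dots> \<longleftrightarrow> same_signs S (- t) (- t')"
    unfolding same_signs_def by (simp add: poly_reflect sgn_mult)
  finally show ?thesis .
qed

section \<open>Order and roots under the correspondence of sign vectors\<close>

lemma matched_deriv_closed:
  "matched S \<Longrightarrow> deriv_closed {(d, f). \<exists>g. (d, f, g) \<in> S}"
  "matched S \<Longrightarrow> deriv_closed {(d, g). \<exists>f. (d, f, g) \<in> S}"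
  unfolding matched_def deriv_closed_def by blast+

lemma matched_zero_iff:
  assumes "matched S" "(d, f, g) \<in> S"
  shows "f = 0 \<longleftrightarrow> g = 0"
proof -
  have "\<And>i. sgn (coeff f i) = sgn (coeff g i)"
    using assms by (auto simp: matched_def)
  then have "coeff f i = 0 \<longleftrightarrow> coeff g i = 0" for i
    by (metis sgn_zero_iff)
  then show ?thesis by (auto simp: poly_eq_iff)
qed

text \<open>Take a member of least formal degree whose signs at \<open>s\<close> and
  \<open>t\<close> differ. By Thom's lemma its derivative has constant sign between \<open>s\<close>
  and \<open>t\<close>, and if the order were reversed also between \<open>t'\<close> and
  \<open>s'\<close>, with the same value. Then \<open>f\<close> and \<open>g\<close> are monotone in
  the same direction, and the change of sign can only occur in one order.\<close>

lemma matched_order: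
  assumes S: "matched S"
    and s: "same_signs S s s'" and t: "same_signs S t t'" and less: "s < t"
    and ne: "(d, f, g) \<in> S" "sgn (poly f s) \<noteq> sgn (poly f t)"
  shows "s' < t'"
proof -
  let ?P = "\<lambda>d. \<exists>f g. (d, f, g) \<in> S \<and> sgn (poly f s) \<noteq> sgn (poly f t)"
  have "\<exists>d. ?P d" using ne by blast
  then obtain d where "?P d" and least: "\<And>k. k < d \<Longrightarrow> \<not> ?P k"
    using exists_least_iff[of ?P] by blast
  then obtain f g where fg: "(d, f, g) \<in> S" "sgn (poly f s) \<noteq> sgn (poly f t)"
    by blast
  have d: "d > 0"
  proof (rule ccontr)
    assume "\<not> d > 0"
    with fg(1) S have "degree f \<le> 0" by (auto simp: matched_def)
    with fg(2) show False by (simp add: degree_0_poly_eq)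
  qed
  have der: "(d - 1, pderiv f, pderiv g) \<in> S"
    using S fg(1) d unfolding matched_def by blast
  \<comment> \<open>Minimality makes the hypothesis of Thom's lemma available up to degree
    \<open>d - 1\<close>, which covers the derivative.\<close>
  have same: "sgn (poly h s) = sgn (poly h t)" if "(k, h, h') \<in> S" "k \<le> d - 1" for k h h'
    using least[of k] that d by fastforce
  have same': "sgn (poly h' s') = sgn (poly h' t')" if "(k, h, h') \<in> S" "k \<le> d - 1" for k h h'
  proof -
    have "sgn (poly h s) = sgn (poly h' s')" "sgn (poly h t) = sgn (poly h' t')"
      using s t that(1) unfolding same_signs_def by blast+
    then show ?thesis using same[OF that] by simp
  qed
  have f': "sgn (poly (pderiv f) x) = sgn (poly (pderiv f) s)" if "s \<le> x" "x \<le> t" for x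
    by (rule thom_sign_condition_convex[OF matched_deriv_closed(1)[OF S], of "d - 1" s t x "d - 1"])
      (use same that der in auto)
  have g': "sgn (poly (pderiv g) x) = sgn (poly (pderiv g) s')" if "t' \<le> x" "x \<le> s'" for x
  proof -
    have "sgn (poly (pderiv g) x) = sgn (poly (pderiv g) t')"
      by (rule thom_sign_condition_convex[OF matched_deriv_closed(2)[OF S], of "d - 1" t' s' x "d - 1"])
        (use same' that der in auto)
    with same'[OF der] show ?thesis by simp
  qed
  have sg: "sgn (poly (pderiv g) s') = sgn (poly (pderiv f) s)"
    using s der by (auto simp: same_signs_def)
  have fgs: "sgn (poly f s) = sgn (poly g s')" "sgn (poly f t) = sgn (poly g t')"
    using s t fg(1) by (auto simp: same_signs_def)
  show ?thesis
  proof (rule ccontr)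
    assume "\<not> s' < t'"
    then have le: "t' \<le> s'" by simp
    show False
    proof (cases "0 \<le> poly (pderiv f) s")
      case True
      have "0 \<le> poly (pderiv f) x" if "s \<le> x" "x \<le> t" for x
        using f'[OF that] True by (auto simp: sgn_real_def split: if_splits)
      moreover have "0 \<le> poly (pderiv g) x" if "t' \<le> x" "x \<le> s'" for x
        using g'[OF that] sg True by (auto simp: sgn_real_def split: if_splits)
      ultimately have "poly f s \<le> poly f t" "poly g t' \<le> poly g s'"
        using less le by (auto intro!: poly_mono_Icc)
      then show False
        using fgs fg(2) sgn_mono_real[of "poly f s" "poly f t"] sgn_mono_real[of "poly g t'" "poly g s'"]
        by linarith
    next
      case False
      have "poly (pderiv f) x \<le> 0" if "s \<le> x" "x \<le> t" for x
        using f'[OF that] False by (auto simp: sgn_real_def split: if_splits)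
      moreover have "poly (pderiv g) x \<le> 0" if "t' \<le> x" "x \<le> s'" for x
        using g'[OF that] sg False by (auto simp: sgn_real_def split: if_splits)
      ultimately have "poly f t \<le> poly f s" "poly g s' \<le> poly g t'"
        using less le by (auto intro!: poly_antimono_Icc)
      then show False
        using fgs fg(2) sgn_mono_real[of "poly f t" "poly f s"] sgn_mono_real[of "poly g s'" "poly g t'"]
        by linarith
    qed
  qed
qed

text \<open>With equal sign vectors at \<open>s\<close> and \<open>t\<close>, Thom's lemma would
  make \<open>f\<close> vanish on the whole interval. The differing member found here is what
  \<open>matched_order\<close> asks for.\<close>

lemma matched_root_unique:
  assumes S: "matched S" and f: "(d, f, g) \<in> S" "f \<noteq> 0" "poly f s = 0" and "s < t"
  shows "\<exists>k h h'. (k, h, h') \<in> S \<and> sgn (poly h s) \<noteq> sgn (poly h t)"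
proof (rule ccontr)
  assume same: "\<not> ?thesis"
  have "sgn (poly f x) = sgn (poly f s)" if "x \<in> {s..t}" for x
    by (rule thom_sign_condition_convex[OF matched_deriv_closed(1)[OF S], of d s t x d])
      (use same that f in auto)
  then have "{s..t} \<subseteq> {x. poly f x = 0}"
    using f(3) by (auto simp: sgn_zero_iff)
  then show False
    using poly_roots_finite[OF f(2)] infinite_Icc[OF \<open>s < t\<close>] finite_subset by blast
qed

text \<open>Since \<open>t\<close> is no root of a nonzero member, its sign vector persists to the
  right of \<open>t'\<close> up to the next root \<open>u'\<close>. If there is none,
  \<open>q\<close> becomes positive far out. Otherwise \<open>p\<close> increases from
  \<open>t\<close> to the corresponding \<open>u\<close>, so \<open>q\<close> is positive at
  \<open>u'\<close> by \<open>roots\<close>, hence also just before it. The factor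
  \<open>\<sigma>\<close> lets the same argument serve \<open>p\<close> and
  \<open>- p\<close>.\<close>

lemma matched_step_up:
  assumes S: "matched S" and bi: "\<And>t'. \<exists>t. same_signs S t t'" "\<And>t. \<exists>t'. same_signs S t t'"
    and tt: "same_signs S t t'"
    and nz: "\<And>d f g. (d, f, g) \<in> S \<Longrightarrow> f \<noteq> 0 \<Longrightarrow> poly f t \<noteq> 0"
    and der: "(c, smult \<sigma> (pderiv p), smult \<sigma> (pderiv q)) \<in> S" "poly (pderiv p) t > 0" "\<sigma> \<noteq> 0"
    and roots: "\<And>d f g z z'. (d, f, g) \<in> S \<Longrightarrow> f \<noteq> 0 \<Longrightarrow> poly f z = 0 \<Longrightarrow> same_signs S z z' \<Longrightarrow>
                  sgn (poly p z) = sgn (poly q z')"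
    and p: "poly p t \<ge> 0"
  shows "\<exists>s'. same_signs S t s' \<and> poly q s' > 0"
proof -
  have der_sgn: "sgn (poly (pderiv p) x) = sgn (poly (pderiv q) x')" if "same_signs S x x'" for x x'
  proof -
    have "sgn (\<sigma> * poly (pderiv p) x) = sgn (\<sigma> * poly (pderiv q) x')"
      using that der(1) unfolding same_signs_def by fastforce
    then show ?thesis using der(3) by (simp add: sgn_mult sgn_zero_iff)
  qed
  define Z where "Z = {z'. z' > t' \<and> (\<exists>d f g. (d, f, g) \<in> S \<and> g \<noteq> 0 \<and> poly g z' = 0)}"
  have "finite (\<Union>(d, f, g) \<in> {(d, f, g) \<in> S. g \<noteq> 0}. {z. poly g z = 0})"
    by (rule finite_UN_I) (use S in \<open>auto simp: matched_def poly_roots_finite intro: finite_subset[of _ S]\<close>)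
  then have finZ: "finite Z"
    by (rule rev_finite_subset) (auto simp: Z_def)
  \<comment> \<open>No nonzero member changes sign between \<open>t'\<close> and the first element
    of \<open>Z\<close>.\<close>
  have near: "same_signs S t s'" if le: "t' \<le> s'" and below: "\<And>z'. z' \<in> Z \<Longrightarrow> s' < z'" for s'
    unfolding same_signs_def
  proof (intro allI impI)
    fix d f g assume dfg: "(d, f, g) \<in> S"
    have tg: "sgn (poly f t) = sgn (poly g t')"
      using tt dfg unfolding same_signs_def by blast
    show "sgn (poly f t) = sgn (poly g s')"
    proof (cases "g = 0")
      case True
      then show ?thesis using tg by simp
    next
      case False
      then have "f \<noteq> 0" using matched_zero_iff[OF S dfg] by simp
      then have t0: "poly g t' \<noteq> 0" using nz[OF dfg] tg by (metis sgn_zero_iff)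
      have "poly g x \<noteq> 0" if x: "t' \<le> x" "x \<le> s'" for x
      proof
        assume g0: "poly g x = 0"
        with t0 x have "x > t'" by (cases "x = t'") auto
        with g0 False dfg have "x \<in> Z" unfolding Z_def by blast
        then show False using below x by force
      qed
      then show ?thesis
        using sgn_poly_constant_on_interval[OF le] tg by metis
    qed
  qed
  have q't: "poly (pderiv q) t' > 0"
  proof -
    have "sgn (poly (pderiv p) t) = sgn (poly (pderiv q) t')"
      using der_sgn[OF tt] .
    then show ?thesis using der(2) by (simp add: sgn_real_def split: if_splits)
  qed
  show ?thesis
  proof (cases "Z = {}")
    case True
    have near': "same_signs S t s'" if "t' \<le> s'" for s'
      using near[OF that] True by simp
    have pos: "poly (pderiv q) x > 0" if "t' \<le> x" for x
    proof -
      have "sgn (poly (pderiv p) t) = sgn (poly (pderiv q) x)"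
        using der_sgn[OF near'[OF that]] .
      then show ?thesis using der(2) by (simp add: sgn_real_def split: if_splits)
    qed
    have "degree q \<noteq> 0"
    proof
      assume "degree q = 0"
      then have "pderiv q = 0" by (simp add: pderiv_eq_0_iff)
      with q't show False by simp
    qed
    then have q0: "q \<noteq> 0" by auto
    \<comment> \<open>\<open>pderiv q\<close> is positive on the whole ray from \<open>t'\<close>; a
      negative leading coefficient of \<open>q\<close> would make it eventually negative.\<close>
    have "lead_coeff q > 0"
    proof (rule ccontr)
      assume "\<not> lead_coeff q > 0"
      with q0 have "lead_coeff (- q) > 0"
        by (simp add: order_less_le lead_coeff_minus)
      define r where "r = pderiv q"
      have "lead_coeff r = of_nat (degree q) * lead_coeff q"
        using \<open>degree q \<noteq> 0\<close> by (simp add: r_def degree_pderiv coeff_pderiv)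
      then have "lead_coeff (- r) > 0"
        using \<open>lead_coeff (- q) > 0\<close> \<open>degree q \<noteq> 0\<close>
        by (simp add: lead_coeff_minus mult_pos_neg)
      then obtain N where "\<And>x. x \<ge> N \<Longrightarrow> poly (- r) x \<ge> lead_coeff (- r)"
        using poly_pinfty_gt_lc by blast
      then have "poly (- r) (max N t') > 0"
        using \<open>lead_coeff (- r) > 0\<close> by (meson max.cobounded1 less_le_trans)
      then show False using pos[of "max N t'"] by (simp add: r_def)
    qed
    then obtain N where "\<And>x. x \<ge> N \<Longrightarrow> poly q x \<ge> lead_coeff q"
      using poly_pinfty_gt_lc by blast
    then have "poly q (max N t') > 0"
      using \<open>lead_coeff q > 0\<close> by (meson max.cobounded1 less_le_trans)
    then show ?thesis using near'[of "max N t'"] by auto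
  next
    case False
    define u' where "u' = Min Z"
    have u'Z: "u' \<in> Z" using False finZ by (simp add: u'_def)
    have u'min: "u' \<le> z'" if "z' \<in> Z" for z' using that finZ by (simp add: u'_def)
    obtain d f g where fg: "(d, f, g) \<in> S" "g \<noteq> 0" "poly g u' = 0" and u't: "u' > t'"
      using u'Z unfolding Z_def by blast
    obtain u where uu: "same_signs S u u'" using bi(1) by blast
    have f0: "f \<noteq> 0" using matched_zero_iff[OF S fg(1)] fg(2) by simp
    have "sgn (poly f u) = sgn (poly g u')"
      using uu fg(1) unfolding same_signs_def by blast
    then have fu: "poly f u = 0" using fg(3) by (simp add: sgn_zero_iff)
    have ut: "t < u"
    proof (rule ccontr)
      assume "\<not> t < u"
      moreover have "u \<noteq> t" using nz[OF fg(1) f0] fu by auto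
      ultimately have "u < t" by simp
      then have "u' < t'"
        by (rule matched_order[OF S uu tt _ fg(1)])
          (use fu nz[OF fg(1) f0] in \<open>simp add: sgn_zero_iff\<close>)
      then show False using u't by simp
    qed
    have p'0: "smult \<sigma> (pderiv p) \<noteq> 0" using der(2,3) by auto
    \<comment> \<open>A root of \<open>pderiv p\<close> in this gap would correspond, by
      preservation of order, to a root of \<open>pderiv q\<close> strictly between \<open>t'\<close>
      and \<open>u'\<close>, against the minimality of \<open>u'\<close>.\<close>
    have no_root: "poly (pderiv p) z \<noteq> 0" if z: "t < z" "z < u" for z
    proof
      assume z0: "poly (pderiv p) z = 0"
      obtain z' where zz: "same_signs S z z'" using bi(2) by blast
      have "t' < z'"
        by (rule matched_order[OF S tt zz z(1) der(1)]) (use z0 der(2,3) in \<open>simp add: sgn_zero_iff\<close>)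
      moreover have "z' < u'"
      proof -
        obtain k h h' where "(k, h, h') \<in> S" "sgn (poly h z) \<noteq> sgn (poly h u)"
          using matched_root_unique[OF S der(1) p'0 _ z(2)] z0 by auto
        then show ?thesis by (rule matched_order[OF S zz uu z(2)])
      qed
      moreover have "z' \<in> Z"
      proof -
        have "poly (smult \<sigma> (pderiv q)) z' = 0"
          using z0 der_sgn[OF zz] by (simp add: sgn_zero_iff)
        moreover have "smult \<sigma> (pderiv q) \<noteq> 0" using matched_zero_iff[OF S der(1)] p'0 by simp
        ultimately show ?thesis using der(1) \<open>t' < z'\<close> unfolding Z_def by blast
      qed
      ultimately show False using u'min by force
    qed
    obtain x where x: "t < x" "x < u" "poly p u - poly p t = (u - t) * poly (pderiv p) x"
      using poly_MVT[OF ut] by blast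
    have "sgn (poly (pderiv p) t) = sgn (poly (pderiv p) x)"
    proof (rule sgn_poly_constant_on_interval)
      fix y assume "t \<le> y" "y \<le> x"
      then show "poly (pderiv p) y \<noteq> 0"
        using no_root[of y] x der(2) by (cases "y = t") auto
    qed (use x in simp)
    then have "poly (pderiv p) x > 0"
      using der(2) by (simp add: sgn_real_def split: if_splits)
    then have "(u - t) * poly (pderiv p) x > 0" using ut by simp
    then have "poly p u > 0" using x(3) p by linarith
    then have qu: "poly q u' > 0"
      using roots[OF fg(1) f0 fu uu] by (simp add: sgn_real_def split: if_splits)
    \<comment> \<open>The point \<open>u'\<close> itself has another sign vector, so positivity is
      carried by continuity to a point inside the gap.\<close>
    have "isCont (poly q) u'" by simp
    then have "(poly q \<longlongrightarrow> poly q u') (at_left u')"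
      by (simp add: isCont_def filterlim_at_split)
    then have "\<forall>\<^sub>F s in at_left u'. poly q s > 0"
      using order_tendstoD(1) qu by blast
    moreover have "\<forall>\<^sub>F s in at_left u'. s > t'"
      using eventually_at_left_real[OF u't] by (rule eventually_mono) auto
    moreover have "\<forall>\<^sub>F s in at_left u'. s < u'"
      by (simp add: eventually_at_filter)
    ultimately have "\<forall>\<^sub>F s in at_left u'. poly q s > 0 \<and> s > t' \<and> s < u'"
      by (simp add: eventually_conj)
    then obtain s where "poly q s > 0" "s > t'" "s < u'"
      using eventually_happens trivial_limit_at_left_real by blast
    then show ?thesis
      using near[of s] u'min by force
  qed
qed

text \<open>The upward step applied to the reflected family and to \<open>- p (- x)\<close>, which
  is again increasing at the reflected point.\<close>

lemma matched_step_down: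
  assumes S: "matched S" and bi: "\<And>t'. \<exists>t. same_signs S t t'" "\<And>t. \<exists>t'. same_signs S t t'"
    and tt: "same_signs S t t'"
    and nz: "\<And>d f g. (d, f, g) \<in> S \<Longrightarrow> f \<noteq> 0 \<Longrightarrow> poly f t \<noteq> 0"
    and der: "(c, smult \<sigma> (pderiv p), smult \<sigma> (pderiv q)) \<in> S" "poly (pderiv p) t > 0" "\<sigma> \<noteq> 0"
    and roots: "\<And>d f g z z'. (d, f, g) \<in> S \<Longrightarrow> f \<noteq> 0 \<Longrightarrow> poly f z = 0 \<Longrightarrow> same_signs S z z' \<Longrightarrow>
                  sgn (poly p z) = sgn (poly q z')"
    and p: "poly p t \<le> 0"
  shows "\<exists>s'. same_signs S t s' \<and> poly q s' < 0"
proof -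
  let ?R = "reflect_family S"
  define P where "P = reflect 1 p"
  define Q where "Q = reflect 1 q"
  have bi': "\<exists>t. same_signs ?R t t'" "\<exists>t'. same_signs ?R t t'" for t t'
    unfolding same_signs_reflect using bi by (metis minus_minus)+
  \<comment> \<open>\<open>p\<close> is reflected at degree 1 but the member of the family at degree
    \<open>c\<close>; the extra sign is put into the scalar.\<close>
  have d1: "smult (\<sigma> * (-1) ^ c) (pderiv P) = reflect c (smult \<sigma> (pderiv p))"
    "smult (\<sigma> * (-1) ^ c) (pderiv Q) = reflect c (smult \<sigma> (pderiv q))"
    by (simp_all add: P_def Q_def pderiv_reflect) (simp_all add: reflect_def pcompose_smult mult.commute)
  have "\<exists>s'. same_signs ?R (- t) s' \<and> poly Q s' > 0"
  proof (rule matched_step_up[OF matched_reflect[OF S] bi', where t' = "- t'" and p = P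
        and c = c and \<sigma> = "\<sigma> * (-1) ^ c"])
    show "same_signs ?R (- t) (- t')" using tt by (simp add: same_signs_reflect)
    show "poly f (- t) \<noteq> 0" if "(d, f, g) \<in> ?R" "f \<noteq> 0" for d f g
      using that nz by (auto simp: reflect_family_def poly_reflect)
    show "(c, smult (\<sigma> * (-1) ^ c) (pderiv P), smult (\<sigma> * (-1) ^ c) (pderiv Q)) \<in> ?R"
      unfolding d1 reflect_family_def using der(1) by force
    show "poly (pderiv P) (- t) > 0"
      using der(2) by (simp add: P_def pderiv_reflect poly_reflect)
    show "\<sigma> * (-1) ^ c \<noteq> 0" using der(3) by simp
    show "0 \<le> poly P (- t)" using p by (simp add: P_def poly_reflect)
    show "sgn (poly P z) = sgn (poly Q z')"
      if h: "(d, f, g) \<in> ?R" "f \<noteq> 0" "poly f z = 0" "same_signs ?R z z'" for d f g z z'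
    proof -
      obtain f0 g0 where "(d, f0, g0) \<in> S" "f = reflect d f0"
        using h(1) by (auto simp: reflect_family_def)
      then have "sgn (poly p (- z)) = sgn (poly q (- z'))"
        using roots[of d f0 g0 "- z" "- z'"] h by (simp add: poly_reflect same_signs_reflect)
      then show ?thesis by (simp add: P_def Q_def poly_reflect sgn_minus)
    qed
  qed
  then obtain s' where "same_signs ?R (- t) s'" "poly Q s' > 0" by blast
  then show ?thesis
    by (intro exI[of _ "- s'"]) (simp add: Q_def poly_reflect same_signs_reflect)
qed

lemma same_signs_between:
  assumes S: "matched S" and "same_signs S t s'" "same_signs S t u'" "s' \<le> x" "x \<le> u'"
  shows "same_signs S t x"
  unfolding same_signs_def
proof (intro allI impI)
  fix d f g assume d: "(d, f, g) \<in> S"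
  have "sgn (poly g x) = sgn (poly g s')"
    by (rule thom_sign_condition_convex[OF matched_deriv_closed(2)[OF S], of d s' u' x d])
      (use assms d in \<open>auto simp: same_signs_def\<close>)
  then show "sgn (poly f t) = sgn (poly g x)"
    using assms(2) d by (simp add: same_signs_def)
qed

text \<open>If \<open>p\<close> is zero at \<open>t\<close>, both the upward and the downward step
  apply, and \<open>q\<close> has a zero between the two points found. Thom's lemma
  (\<open>same_signs_between\<close>) keeps that zero within the same sign vector.\<close>

lemma matched_step_increasing:
  assumes S: "matched S" and bi: "\<And>t'. \<exists>t. same_signs S t t'" "\<And>t. \<exists>t'. same_signs S t t'"
    and nz: "\<And>d f g. (d, f, g) \<in> S \<Longrightarrow> f \<noteq> 0 \<Longrightarrow> poly f t \<noteq> 0"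
    and der: "(c, smult \<sigma> (pderiv p), smult \<sigma> (pderiv q)) \<in> S" "poly (pderiv p) t > 0" "\<sigma> \<noteq> 0"
    and roots: "\<And>d f g z z'. (d, f, g) \<in> S \<Longrightarrow> f \<noteq> 0 \<Longrightarrow> poly f z = 0 \<Longrightarrow> same_signs S z z' \<Longrightarrow>
                  sgn (poly p z) = sgn (poly q z')"
  shows "\<exists>s'. same_signs S t s' \<and> sgn (poly p t) = sgn (poly q s')"
proof -
  obtain t' where tt: "same_signs S t t'" using bi(2) by blast
  note up = matched_step_up[OF S bi tt nz der roots]
  note down = matched_step_down[OF S bi tt nz der roots]
  consider "poly p t > 0" | "poly p t < 0" | "poly p t = 0" by linarith
  then show ?thesis
  proof cases
    case 1
    then obtain s' where "same_signs S t s'" "poly q s' > 0" using up by force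
    with 1 show ?thesis by auto
  next
    case 2
    then obtain s' where "same_signs S t s'" "poly q s' < 0" using down by force
    with 2 show ?thesis by auto
  next
    case 3
    obtain u where u: "same_signs S t u" "poly q u > 0" using up 3 by force
    obtain l where l: "same_signs S t l" "poly q l < 0" using down 3 by force
    have "\<exists>x. min l u \<le> x \<and> x \<le> max l u \<and> poly q x = 0"
    proof (cases "l < u")
      case True
      obtain x where "l < x" "x < u" "poly q x = 0"
        using poly_IVT_pos[OF True l(2) u(2)] by blast
      with True show ?thesis by (intro exI[of _ x]) auto
    next
      case False
      then have "u < l" using l u by (cases "u = l") auto
      obtain x where "u < x" "x < l" "poly q x = 0"
        using poly_IVT_neg[OF \<open>u < l\<close> u(2) l(2)] by blast
      with \<open>u < l\<close> show ?thesis by (intro exI[of _ x]) auto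
    qed
    then obtain x where x: "min l u \<le> x" "x \<le> max l u" "poly q x = 0" by blast
    have "same_signs S t x"
      by (rule same_signs_between[OF S _ _ x(1,2)]) (use l u in \<open>auto simp: min_def max_def\<close>)
    then show ?thesis using x 3 by auto
  qed
qed

text \<open>Vanishing top coefficients are stripped by truncation, which leaves \<open>f\<close>
  unchanged. The descent stops before degree 0, since a nonzero constant has no root.
  Pseudo-division by \<open>f\<close> then has a nonzero multiplier.\<close>

lemma remainder_closed_leading_root:
  assumes S: "matched S" "remainder_closed S" and f: "(d, f, g) \<in> S" "f \<noteq> 0" "poly f t = 0"
  shows "\<exists>n g'. (n, f, g') \<in> S \<and> 0 < n \<and> n \<le> d \<and> coeff f n \<noteq> 0"
  using f
proof (induction d arbitrary: g)
  case 0
  then have "degree f \<le> 0" using S by (auto simp: matched_def)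
  then have "f = 0" using 0 by (metis degree_0_poly_eq poly_0_coeff_0 leading_coeff_0_iff le_zero_eq)
  then show ?case using 0 by simp
next
  case (Suc d)
  show ?case
  proof (cases "coeff f (Suc d) = 0")
    case False
    then show ?thesis using Suc.prems by blast
  next
    case True
    have "(Suc d - 1, f - monom (coeff f (Suc d)) (Suc d), g - monom (coeff g (Suc d)) (Suc d)) \<in> S"
      using S(2) Suc.prems(1) unfolding remainder_closed_def by blast
    then have "(d, f, g - monom (coeff g (Suc d)) (Suc d)) \<in> S"
      using True by simp
    from Suc.IH[OF this Suc.prems(2,3)] show ?thesis by (meson le_SucI)
  qed
qed

text \<open>The Cohen--Hoermander step: at a root of some \<open>f\<close> in the family the sign of \<open>p\<close> is that of
  its remainder modulo \<open>f\<close>, and between consecutive roots \<open>p\<close> is strictly monotone because its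
  derivative belongs to the family.\<close>

lemma matched_step:
  assumes ins: "matched (insert (m, p, q) S)" "remainder_closed (insert (m, p, q) S)"
    and S: "matched S" "remainder_closed S"
    and top: "\<And>d f g. (d, f, g) \<in> S \<Longrightarrow> d \<le> m"
    and bi: "\<And>t'. \<exists>t. same_signs S t t'" "\<And>t. \<exists>t'. same_signs S t t'"
  shows "\<exists>t'. same_signs (insert (m, p, q) S) t t'"
proof -
  have same_insert: "same_signs (insert (m, p, q) S) t t' \<longleftrightarrow>
      same_signs S t t' \<and> sgn (poly p t) = sgn (poly q t')" for t t'
    unfolding same_signs_def by blast
  have pq: "degree p \<le> m" "degree q \<le> m" "\<And>i. sgn (coeff p i) = sgn (coeff q i)"
    using ins(1) by (auto simp: matched_def)
  obtain t' where tt: "same_signs S t t'" using bi(2) by blast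
  consider "m = 0" | "m > 0" "coeff p m = 0" | "m > 0" "coeff p m \<noteq> 0" by blast
  then show ?thesis
  proof cases
    case 1
    then have "degree p \<le> 0" "degree q \<le> 0" using pq by auto
    then show ?thesis using tt pq(3)[of 0] by (auto simp: same_insert degree_0_poly_eq)
  next
    case 2
    then have "coeff q m = 0" using pq(3)[of m] by (simp add: sgn_zero_iff)
    moreover have "(m - 1, p - monom (coeff p m) m, q - monom (coeff q m) m) \<in> insert (m, p, q) S"
      using ins(2) 2(1) unfolding remainder_closed_def by blast
    ultimately have "(m - 1, p, q) \<in> S" using 2 by auto
    then have "sgn (poly p t) = sgn (poly q t')"
      using tt unfolding same_signs_def by blast
    then show ?thesis using tt by (auto simp: same_insert)
  next
    case 3
    have roots: "sgn (poly p z) = sgn (poly q z')"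
      if h: "(d, f, g) \<in> S" "f \<noteq> 0" "poly f z = 0" "same_signs S z z'" for d f g z z'
    proof -
      obtain n g' where n: "(n, f, g') \<in> S" "0 < n" "coeff f n \<noteq> 0"
        using remainder_closed_leading_root[OF S h(1-3)] by blast
      have "\<exists>k r r'. (n - 1, r, r') \<in> insert (m, p, q) S \<and> f dvd smult (coeff f n ^ k) p - r \<and>
           g' dvd smult (coeff g' n ^ k) q - r'"
        using ins(2) n top[OF n(1)] unfolding remainder_closed_def by blast
      then obtain k r r' where r: "(n - 1, r, r') \<in> insert (m, p, q) S"
          "f dvd smult (coeff f n ^ k) p - r" "g' dvd smult (coeff g' n ^ k) q - r'"
        by blast
      \<comment> \<open>The remainder has formal degree below \<open>m\<close>, so it is not the new
        member and its signs are already matched.\<close>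
      have "n - 1 < m" using n top[OF n(1)] by simp
      then have rS: "(n - 1, r, r') \<in> S" using r(1) by auto
      have "sgn (poly f z) = sgn (poly g' z')"
        using h(4) n(1) unfolding same_signs_def by blast
      then have g0: "poly g' z' = 0" using h(3) by (simp add: sgn_zero_iff)
      have e1: "coeff f n ^ k * poly p z = poly r z"
        using r(2) h(3) by (auto elim!: dvdE simp: algebra_simps dest!: arg_cong[where f = "\<lambda>u. poly u z"])
      have e2: "coeff g' n ^ k * poly q z' = poly r' z'"
        using r(3) g0 by (auto elim!: dvdE simp: algebra_simps dest!: arg_cong[where f = "\<lambda>u. poly u z'"])
      have c: "sgn (coeff f n) = sgn (coeff g' n)"
        using S(1) n(1) unfolding matched_def by blast
      have "sgn (poly r z) = sgn (poly r' z')"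
        using h(4) rS unfolding same_signs_def by blast
      then have "sgn (coeff f n) ^ k * sgn (poly p z) = sgn (coeff f n) ^ k * sgn (poly q z')"
        unfolding e1[symmetric] e2[symmetric] by (simp add: sgn_mult power_sgn c)
      then show ?thesis using n(3) by (simp add: sgn_zero_iff)
    qed
    show ?thesis
    proof (cases "\<exists>d f g. (d, f, g) \<in> S \<and> f \<noteq> 0 \<and> poly f t = 0")
      case True
      then show ?thesis using roots tt by (auto simp: same_insert)
    next
      case False
      then have nz: "\<And>d f g. (d, f, g) \<in> S \<Longrightarrow> f \<noteq> 0 \<Longrightarrow> poly f t \<noteq> 0" by blast
      have "(m - 1, pderiv p, pderiv q) \<in> insert (m, p, q) S"
        using ins(1) 3(1) unfolding matched_def by blast
      then have der: "(m - 1, pderiv p, pderiv q) \<in> S" using 3(1) by auto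
      \<comment> \<open>The derivative of \<open>p\<close> is a nonzero member of \<open>S\<close>,
        and \<open>t\<close> is a root of no such member, so \<open>p\<close> is strictly monotone
        near \<open>t\<close>.\<close>
      have "degree p \<noteq> 0" using 3 pq(1) by (metis coeff_eq_0 not_gr_zero le_antisym)
      then have "pderiv p \<noteq> 0" by (simp add: pderiv_eq_0_iff)
      then have "poly (pderiv p) t \<noteq> 0" using nz[OF der] by blast
      then consider "poly (pderiv p) t > 0" | "poly (pderiv p) t < 0" by linarith
      then show ?thesis
      proof cases
        case 1
        have "\<exists>s'. same_signs S t s' \<and> sgn (poly p t) = sgn (poly q s')"
          by (rule matched_step_increasing[OF S(1) bi nz, where c = "m - 1" and \<sigma> = 1])
            (use der 1 roots in auto)
        then show ?thesis by (simp add: same_insert)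
      next
        case 2
        have "\<exists>s'. same_signs S t s' \<and> sgn (poly (- p) t) = sgn (poly (- q) s')"
          by (rule matched_step_increasing[OF S(1) bi nz, where c = "m - 1" and \<sigma> = "-1"])
            (use der 2 roots in \<open>auto simp: pderiv_minus sgn_minus\<close>)
        then show ?thesis by (auto simp: same_insert sgn_minus)
      qed
    qed
  qed
qed

text \<open>Members are inserted in order of formal degree. Derivatives, truncations and remainders
  all have smaller formal degree than the member they come from, or than the divisor, so every
  initial segment of the family is closed as well.\<close>

theorem matched_same_signs:
  assumes "matched S" "remainder_closed S"
  shows "(\<forall>t. \<exists>t'. same_signs S t t') \<and> (\<forall>t'. \<exists>t. same_signs S t t')"
proof -
  have "finite S" using assms(1) by (simp add: matched_def)
  then show ?thesis
    using assms
  proof (induction S rule: finite_ranking_induct[where f = fst])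
    case empty
    then show ?case by (simp add: same_signs_def)
  next
    case (insert x S)
    obtain m p q where x: "x = (m, p, q)" by (cases x)
    have top: "d \<le> m" if "(d, f, g) \<in> S" for d f g
      using insert.hyps(2)[OF that] x by simp
    have S: "matched S"
      unfolding matched_def
    proof (intro conjI allI impI)
      fix d f g assume h: "(d, f, g) \<in> S"
      then show "degree f \<le> d" "degree g \<le> d" "\<And>i. sgn (coeff f i) = sgn (coeff g i)"
        using insert.prems(1) unfolding matched_def by blast+
      assume "0 < d"
      then have "(d - 1, pderiv f, pderiv g) \<in> insert x S"
        using insert.prems(1) h unfolding matched_def by blast
      moreover have "d - 1 < m" using top[OF h] \<open>0 < d\<close> by simp
      ultimately show "(d - 1, pderiv f, pderiv g) \<in> S" using x by auto
    qed (use insert in auto)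
    have R: "remainder_closed S"
      unfolding remainder_closed_def
    proof (intro conjI allI impI)
      fix d f g assume h: "(d, f, g) \<in> S" "0 < d"
      then have "(d - 1, f - monom (coeff f d) d, g - monom (coeff g d) d) \<in> insert x S"
        using insert.prems(2) unfolding remainder_closed_def by blast
      moreover have "d - 1 < m" using top[OF h(1)] h(2) by simp
      ultimately show "(d - 1, f - monom (coeff f d) d, g - monom (coeff g d) d) \<in> S"
        using x by auto
    next
      fix k p' q' n f g assume h: "(k, p', q') \<in> S" "(n, f, g) \<in> S" "0 < n" "n \<le> k"
      then have "\<exists>k r r'. (n - 1, r, r') \<in> insert x S \<and> f dvd smult (coeff f n ^ k) p' - r \<and>
           g dvd smult (coeff g n ^ k) q' - r'"
        using insert.prems(2) unfolding remainder_closed_def by blast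
      moreover have "n - 1 < m" using top[OF h(2)] h(3) by simp
      ultimately show "\<exists>k r r'. (n - 1, r, r') \<in> S \<and> f dvd smult (coeff f n ^ k) p' - r \<and>
           g dvd smult (coeff g n ^ k) q' - r'"
        using x by fastforce
    qed
    have bi: "\<exists>t'. same_signs S t t'" "\<exists>t. same_signs S t t'" for t t'
      using insert.IH[OF S R] by blast+
    have "\<exists>t'. same_signs (insert x S) t t'" for t
      unfolding x by (rule matched_step[OF insert.prems[unfolded x] S R _ bi(2,1)]) (rule top)
    moreover have "\<exists>t. same_signs (insert x S) t t'" for t'
    proof -
      \<comment> \<open>The converse direction is the same step with the two specialisations
        exchanged.\<close>
      have sw: "swap_family (insert x S) = insert (m, q, p) (swap_family S)"
        by (auto simp: x swap_family_def)
      have "\<exists>t. same_signs (insert (m, q, p) (swap_family S)) t' t"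
      proof (rule matched_step)
        show "matched (insert (m, q, p) (swap_family S))"
          using matched_swap[OF insert.prems(1)] sw by simp
        show "remainder_closed (insert (m, q, p) (swap_family S))"
          using remainder_closed_swap[OF insert.prems(2)] sw by simp
      qed (use matched_swap[OF S] remainder_closed_swap[OF R] top bi in auto)
      then show ?thesis by (metis sw same_signs_swap)
    qed
    ultimately show ?case by blast
  qed
qed

section \<open>Quantifier elimination\<close>

inductive env_poly :: "((nat \<Rightarrow> real ^ 'n) \<Rightarrow> real) \<Rightarrow> bool" where
  env_poly_const: "env_poly (\<lambda>e. c)"
| env_poly_coord: "env_poly (\<lambda>e. e k $ i)"
| env_poly_add: "env_poly f \<Longrightarrow> env_poly g \<Longrightarrow> env_poly (\<lambda>e. f e + g e)"
| env_poly_mult: "env_poly f \<Longrightarrow> env_poly g \<Longrightarrow> env_poly (\<lambda>e. f e * g e)"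

lemma env_poly_diff:
  assumes "env_poly f" "env_poly g"
  shows "env_poly (\<lambda>e. f e - g e)"
  using env_poly_add[OF assms(1) env_poly_mult[OF env_poly_const[of "-1"] assms(2)]] by simp

lemma env_poly_sum: "(\<And>i. i \<in> I \<Longrightarrow> env_poly (f i)) \<Longrightarrow> env_poly (\<lambda>e. \<Sum>i\<in>I. f i e)"
  by (induction I rule: infinite_finite_induct) (auto intro: env_poly_const env_poly_add)

text \<open>The degree bound is uniform in the parameters, while the true degree may drop for
  special values.\<close>

definition param_poly :: "nat \<Rightarrow> ((nat \<Rightarrow> real ^ 'n) \<Rightarrow> real poly) \<Rightarrow> bool" where
  "param_poly d P \<longleftrightarrow> (\<forall>e. degree (P e) \<le> d) \<and> (\<forall>i. env_poly (\<lambda>e. coeff (P e) i))"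

lemma param_poly_mono: "param_poly d P \<Longrightarrow> d \<le> d' \<Longrightarrow> param_poly d' P"
  unfolding param_poly_def using le_trans by blast

lemma param_poly_pderiv: "param_poly d P \<Longrightarrow> param_poly (d - 1) (\<lambda>e. pderiv (P e))"
  unfolding param_poly_def
  by (auto simp: degree_pderiv coeff_pderiv diff_le_mono intro!: env_poly_mult env_poly_const)

lemma degree_drop_leading:
  fixes p :: "real poly"
  assumes "degree p \<le> d" "0 < d"
  shows "coeff p d = 0 \<Longrightarrow> degree p \<le> d - 1"
proof (rule degree_le, intro allI impI)
  fix i assume "coeff p d = 0" "d - 1 < i"
  then show "coeff p i = 0"
    using assms by (cases "i = d") (auto intro!: coeff_eq_0)
qed

lemma param_poly_truncate:
  assumes "param_poly d P" "0 < d"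
  shows "param_poly (d - 1) (\<lambda>e. P e - monom (coeff (P e) d) d)"
  unfolding param_poly_def
proof (intro conjI allI)
  fix e
  have "degree (P e) \<le> d" using assms by (simp add: param_poly_def)
  then have "degree (P e - monom (coeff (P e) d) d) \<le> d"
    by (meson degree_diff_le degree_monom_le)
  then show "degree (P e - monom (coeff (P e) d) d) \<le> d - 1"
    using assms(2) by (rule degree_drop_leading) simp
next
  fix i
  show "env_poly (\<lambda>e. coeff (P e - monom (coeff (P e) d) d) i)"
    using assms by (cases "i = d") (auto simp: param_poly_def env_poly_const)
qed

text \<open>Pseudo-division carried out uniformly in the parameters: each step cancels the
  coefficient of formal degree \<open>m\<close>, whether or not it vanishes at a given
  \<open>e\<close>, so the number of steps and the exponent \<open>k\<close> do not depend on
  \<open>e\<close>.\<close>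

lemma param_poly_remainder:
  assumes Q: "param_poly n Q" "0 < n" and "param_poly m P"
  shows "\<exists>k R. param_poly (n - 1) R \<and> (\<forall>e. Q e dvd smult (coeff (Q e) n ^ k) (P e) - R e)"
  using assms(3)
proof (induction m arbitrary: P rule: less_induct)
  case (less m)
  show ?case
  proof (cases "m < n")
    case True
    then have "param_poly (n - 1) P" using less.prems by (rule_tac param_poly_mono) auto
    then show ?thesis by (intro exI[of _ 0] exI[of _ P]) simp
  next
    case False
    then have mn: "n \<le> m" "0 < m" using Q by auto
    define P1 where
      "P1 e = smult (coeff (Q e) n) (P e) - monom (coeff (P e) m) (m - n) * Q e" for e
    have P1: "param_poly (m - 1) P1"
      unfolding param_poly_def
    proof (intro conjI allI)
      fix e
      have dP: "degree (P e) \<le> m" and dQ: "degree (Q e) \<le> n"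
        using less.prems Q by (auto simp: param_poly_def)
      have "degree (monom (coeff (P e) m) (m - n) * Q e) \<le> (m - n) + n"
        by (rule order_trans[OF degree_mult_le]) (intro add_mono degree_monom_le dQ)
      then have "degree (monom (coeff (P e) m) (m - n) * Q e) \<le> m" using mn by simp
      moreover have "degree (smult (coeff (Q e) n) (P e)) \<le> m"
        using dP degree_smult_le le_trans by blast
      ultimately have "degree (P1 e) \<le> m"
        unfolding P1_def by (rule degree_diff_le[rotated])
      then show "degree (P1 e) \<le> m - 1"
        using mn(2) by (rule degree_drop_leading) (use mn in \<open>simp add: P1_def coeff_monom_mult\<close>)
    next
      fix i
      have "env_poly (\<lambda>e. coeff (P e) i)" "env_poly (\<lambda>e. coeff (Q e) i)" for i
        using less.prems Q by (auto simp: param_poly_def)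
      then show "env_poly (\<lambda>e. coeff (P1 e) i)"
        by (cases "i < m - n")
          (auto simp: P1_def coeff_monom_mult intro!: env_poly_diff env_poly_mult env_poly_const)
    qed
    have "m - 1 < m" using mn by simp
    from less.IH[OF this P1] obtain k R where
      R: "param_poly (n - 1) R" "\<And>e. Q e dvd smult (coeff (Q e) n ^ k) (P1 e) - R e" by blast
    have "Q e dvd smult (coeff (Q e) n ^ Suc k) (P e) - R e" for e
    proof -
      have eq: "smult (coeff (Q e) n ^ Suc k) (P e) - R e =
          (smult (coeff (Q e) n ^ k) (P1 e) - R e) +
          smult (coeff (Q e) n ^ k) (monom (coeff (P e) m) (m - n)) * Q e"
        by (simp add: P1_def smult_diff_right mult.commute)
      show ?thesis by (subst eq) (rule dvd_add[OF R(2) dvd_triv_right])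
    qed
    with R(1) show ?thesis by blast
  qed
qed

text \<open>The threshold \<open>n\<close> records progress of the closure: operations on members of
  formal degree at least \<open>n\<close>, and remainders by such divisors, are already
  done.\<close>

definition closed_above ::
  "nat \<Rightarrow> (nat \<times> ((nat \<Rightarrow> real ^ 'n) \<Rightarrow> real poly)) set \<Rightarrow> bool" where
  "closed_above n G \<longleftrightarrow>
     (\<forall>d P. (d, P) \<in> G \<longrightarrow> n \<le> d \<longrightarrow> 0 < d \<longrightarrow> (d - 1, \<lambda>e. pderiv (P e)) \<in> G \<and>
        (d - 1, \<lambda>e. P e - monom (coeff (P e) d) d) \<in> G) \<and>
     (\<forall>m P l Q. (m, P) \<in> G \<longrightarrow> (l, Q) \<in> G \<longrightarrow> n \<le> l \<longrightarrow> 0 < l \<longrightarrow> l \<le> m \<longrightarrow>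
        (\<exists>k R. (l - 1, R) \<in> G \<and> (\<forall>e. Q e dvd smult (coeff (Q e) l ^ k) (P e) - R e)))"

text \<open>Every clause is guarded by positive degree, so thresholds 0 and 1 amount to the
  same.\<close>

lemma closed_above_0:
  assumes "closed_above (Suc 0) G"
  shows "closed_above 0 G"
  using assms unfolding closed_above_def by (simp add: Suc_le_eq)

text \<open>The operations applied to a member of formal degree \<open>n\<close> only create members of smaller
  formal degree, so the closure can be completed one degree at a time, from the top.\<close>

lemma finite_closure:
  assumes "finite F" "\<And>d P. (d, P) \<in> F \<Longrightarrow> param_poly d P"
  shows "\<exists>G. F \<subseteq> G \<and> finite G \<and> (\<forall>d P. (d, P) \<in> G \<longrightarrow> param_poly d P) \<and> closed_above 0 G"
proof -
  obtain D where D: "\<And>d P. (d, P) \<in> F \<Longrightarrow> d \<le> D"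
    using finite_nat_set_iff_bounded_le[of "fst ` F"] assms(1) by force
  let ?C = "\<lambda>n G. F \<subseteq> G \<and> finite G \<and> (\<forall>d P. (d, P) \<in> G \<longrightarrow> param_poly d P \<and> d \<le> D) \<and>
    closed_above n G"
  have "\<exists>G. ?C 0 G"
  \<comment> \<open>Downward induction on the threshold, starting at \<open>Suc D\<close>, where the
    closure condition on \<open>F\<close> is vacuous.\<close>
  proof (rule inc_induct[of 0 "Suc D" "\<lambda>n. \<exists>G. ?C n G"])
    have "closed_above (Suc D) F"
      unfolding closed_above_def using D by (auto dest!: D)
    then have "?C (Suc D) F" using assms D by blast
    then show "\<exists>G. ?C (Suc D) G" by blast
  next
    fix n assume "n < Suc D" and "\<exists>G. ?C (Suc n) G"
    then obtain G where G: "F \<subseteq> G" "finite G" "\<And>d P. (d, P) \<in> G \<Longrightarrow> param_poly d P"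
      "\<And>d P. (d, P) \<in> G \<Longrightarrow> d \<le> D" "closed_above (Suc n) G" by blast
    show "\<exists>G. ?C n G"
    proof (cases "n = 0")
      case True
      then have "closed_above n G" using closed_above_0 G(5) by simp
      then show ?thesis using G(1-4) by (intro exI[of _ G]) simp
    next
      case False
      \<comment> \<open>One remainder is fixed for each pair, so that only finitely many members are
        added.\<close>
      define Rem where "Rem P Q = (SOME R. param_poly (n - 1) R \<and>
        (\<exists>k. \<forall>e. Q e dvd smult (coeff (Q e) n ^ k) (P e) - R e))" for P Q :: "(nat \<Rightarrow> real ^ 'a) \<Rightarrow> real poly"
      have Rem: "param_poly (n - 1) (Rem P Q) \<and>
          (\<exists>k. \<forall>e. Q e dvd smult (coeff (Q e) n ^ k) (P e) - Rem P Q e)"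
        if "(m, P) \<in> G" "(n, Q) \<in> G" for m P Q
      proof -
        have "\<exists>R. param_poly (n - 1) R \<and> (\<exists>k. \<forall>e. Q e dvd smult (coeff (Q e) n ^ k) (P e) - R e)"
          using param_poly_remainder[OF G(3)[OF that(2)] _ G(3)[OF that(1)]] False by blast
        from someI_ex[OF this] show ?thesis unfolding Rem_def .
      qed
      define M where "M = (\<lambda>P. (n - 1, \<lambda>e. pderiv (P e))) ` {P. (n, P) \<in> G} \<union>
        (\<lambda>P. (n - 1, \<lambda>e. P e - monom (coeff (P e) n) n)) ` {P. (n, P) \<in> G} \<union>
        (\<lambda>(P, Q). (n - 1, Rem P Q)) ` (snd ` G \<times> {P. (n, P) \<in> G})"
      have "{P. (n, P) \<in> G} \<subseteq> snd ` G" by force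
      then have "finite {P. (n, P) \<in> G}" using G(2) finite_subset by blast
      then have finM: "finite M"
        unfolding M_def using G(2) by blast
      have M1: "d = n - 1 \<and> param_poly d P" if "(d, P) \<in> M" for d P
      proof -
        consider P0 where "d = n - 1" "(n, P0) \<in> G" "P = (\<lambda>e. pderiv (P0 e))"
          | P0 where "d = n - 1" "(n, P0) \<in> G" "P = (\<lambda>e. P0 e - monom (coeff (P0 e) n) n)"
          | m P0 Q where "d = n - 1" "(m, P0) \<in> G" "(n, Q) \<in> G" "P = Rem P0 Q"
          using \<open>(d, P) \<in> M\<close> unfolding M_def by fastforce
        then show ?thesis
          using G(3) param_poly_pderiv param_poly_truncate Rem \<open>n \<noteq> 0\<close> by cases blast+
      qed
      have M2: "(n - 1, \<lambda>e. pderiv (P e)) \<in> M" "(n - 1, \<lambda>e. P e - monom (coeff (P e) n) n) \<in> M"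
        if "(n, P) \<in> G" for P
        using that unfolding M_def by blast+
      have M3: "(n - 1, Rem P Q) \<in> M" if "(m, P) \<in> G" "(n, Q) \<in> G" for m P Q
      proof -
        have "P \<in> snd ` G" using that(1) by force
        then have "(P, Q) \<in> snd ` G \<times> {P. (n, P) \<in> G}" using that(2) by simp
        then show ?thesis unfolding M_def by (intro UnI2 image_eqI[of _ _ "(P, Q)"]) auto
      qed
      \<comment> \<open>Everything added has formal degree \<open>n - 1\<close>, so the members of
        degree at least \<open>n\<close>, and the closure already obtained for them, are
        unaffected.\<close>
      have low: "(d, P) \<in> G" if "(d, P) \<in> G \<union> M" "n \<le> d" for d P
        using that M1[of d P] False by auto
      have "closed_above n (G \<union> M)"
        unfolding closed_above_def
      proof (rule conjI; intro allI impI)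
        fix d P assume h: "(d, P) \<in> G \<union> M" "n \<le> d" "0 < d"
        show "(d - 1, \<lambda>e. pderiv (P e)) \<in> G \<union> M \<and>
          (d - 1, \<lambda>e. P e - monom (coeff (P e) d) d) \<in> G \<union> M"
        proof (cases "d = n")
          case True
          then show ?thesis using M2 low[OF h(1,2)] by simp
        next
          case False
          then have "Suc n \<le> d" using h by simp
          then show ?thesis using G(5) low[OF h(1,2)] h(3) unfolding closed_above_def by blast
        qed
      next
        fix m P l Q assume h: "(m, P) \<in> G \<union> M" "(l, Q) \<in> G \<union> M" "n \<le> l" "0 < l" "l \<le> m"
        have hG: "(m, P) \<in> G" "(l, Q) \<in> G" using low h by force+
        show "\<exists>k R. (l - 1, R) \<in> G \<union> M \<and> (\<forall>e. Q e dvd smult (coeff (Q e) l ^ k) (P e) - R e)"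
        proof (cases "l = n")
          case True
          then show ?thesis using M3[of m P Q] Rem[of m P Q] hG by blast
        next
          case False
          then have "Suc n \<le> l" using h by simp
          then show ?thesis using G(5) hG h(4,5) unfolding closed_above_def by blast
        qed
      qed
      moreover have "param_poly d P \<and> d \<le> D" if "(d, P) \<in> G \<union> M" for d P
      proof (cases "(d, P) \<in> G")
        case True
        then show ?thesis using G by blast
      next
        case False
        then have dM: "(d, P) \<in> M" using that by blast
        then show ?thesis using M1[OF dM] \<open>n < Suc D\<close> by auto
      qed
      ultimately show ?thesis using G(1,2) finM by (intro exI[of _ "G \<union> M"]) auto
    qed
  qed simp
  then show ?thesis by blast
qed

text \<open>The test polynomials are the coefficients of a finite closure of \<open>F\<close>. Equal
  signs of these make the two specialisations a matched family, to which
  \<open>matched_same_signs\<close> applies.\<close>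

lemma quantifier_elimination_step:
  assumes "finite F" "\<And>d P. (d, P) \<in> F \<Longrightarrow> param_poly d P"
  shows "\<exists>B. finite B \<and> (\<forall>b\<in>B. env_poly b) \<and>
    (\<forall>e e'. (\<forall>b\<in>B. sgn (b e) = sgn (b e')) \<longrightarrow>
       (\<forall>t. \<exists>t'. \<forall>d P. (d, P) \<in> F \<longrightarrow> sgn (poly (P e) t) = sgn (poly (P e') t')))"
proof -
  obtain G where G: "F \<subseteq> G" "finite G" "\<And>d P. (d, P) \<in> G \<Longrightarrow> param_poly d P" "closed_above 0 G"
    using finite_closure[OF assms] by blast
  define B where "B = (\<Union>(d, P)\<in>G. (\<lambda>i e. coeff (P e) i) ` {..d})"
  have "finite B" using G(2) by (auto simp: B_def)
  moreover have "\<forall>b\<in>B. env_poly b" using G(3) by (auto simp: B_def param_poly_def)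
  moreover have "\<forall>t. \<exists>t'. \<forall>d P. (d, P) \<in> F \<longrightarrow> sgn (poly (P e) t) = sgn (poly (P e') t')"
    if e: "\<forall>b\<in>B. sgn (b e) = sgn (b e')" for e e'
  proof -
    define S where "S = (\<lambda>(d, P). (d, P e, P e')) ` G"
    have S_iff: "(d, f, g) \<in> S \<longleftrightarrow> (\<exists>P. (d, P) \<in> G \<and> f = P e \<and> g = P e')" for d f g
      by (force simp: S_def)
    have "matched S"
      unfolding matched_def
    proof (intro conjI allI impI)
      show "finite S" using G(2) by (simp add: S_def)
      fix d f g assume "(d, f, g) \<in> S"
      then obtain P where P: "(d, P) \<in> G" "f = P e" "g = P e'" using S_iff by blast
      show deg: "degree f \<le> d" "degree g \<le> d" using G(3)[OF P(1)] P by (auto simp: param_poly_def)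
      show "sgn (coeff f i) = sgn (coeff g i)" for i
      proof (cases "i \<le> d")
        case True
        then have "(\<lambda>e. coeff (P e) i) \<in> B" using P(1) by (force simp: B_def)
        then show ?thesis using e P by force
      next
        case False
        then show ?thesis using deg by (simp add: coeff_eq_0)
      qed
      assume "0 < d"
      then show "(d - 1, pderiv f, pderiv g) \<in> S"
        using G(4) P unfolding closed_above_def S_iff by blast
    qed
    moreover have "remainder_closed S"
      unfolding remainder_closed_def
    proof (intro conjI allI impI)
      fix d f g assume "(d, f, g) \<in> S" and d: "0 < d"
      then obtain P where P: "(d, P) \<in> G" "f = P e" "g = P e'" using S_iff by blast
      then have "(d - 1, \<lambda>e. P e - monom (coeff (P e) d) d) \<in> G"
        using G(4) d unfolding closed_above_def by blast
      then show "(d - 1, f - monom (coeff f d) d, g - monom (coeff g d) d) \<in> S"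
        unfolding S_iff using P by blast
    next
      fix m p q n f g assume h: "(m, p, q) \<in> S" "(n, f, g) \<in> S" "0 < n" "n \<le> m"
      obtain P where P: "(m, P) \<in> G" "p = P e" "q = P e'" using S_iff h by blast
      obtain Q where Q: "(n, Q) \<in> G" "f = Q e" "g = Q e'" using S_iff h by blast
      obtain k R where "(n - 1, R) \<in> G" "\<forall>e. Q e dvd smult (coeff (Q e) n ^ k) (P e) - R e"
        using G(4) P(1) Q(1) h(3,4) unfolding closed_above_def by blast
      then show "\<exists>k r r'. (n - 1, r, r') \<in> S \<and> f dvd smult (coeff f n ^ k) p - r \<and>
           g dvd smult (coeff g n ^ k) q - r'"
        unfolding S_iff P Q by blast
    qed
    ultimately have S: "\<forall>t. \<exists>t'. same_signs S t t'" using matched_same_signs by blast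
    show ?thesis
    proof
      fix t
      obtain t' where t': "same_signs S t t'" using S by blast
      have "sgn (poly (P e) t) = sgn (poly (P e') t')" if "(d, P) \<in> F" for d P
      proof -
        have "(d, P e, P e') \<in> S" using that G(1) S_iff by blast
        then show ?thesis using t' unfolding same_signs_def by blast
      qed
      then show "\<exists>t'. \<forall>d P. (d, P) \<in> F \<longrightarrow> sgn (poly (P e) t) = sgn (poly (P e') t')" by blast
    qed
  qed
  ultimately show ?thesis by blast
qed

text \<open>Definable without reference to formulas: the truth value depends only on the signs of finitely
  many polynomials in the variables. A variable ranges over vectors, \<open>e k\<close> being the \<open>k\<close>-th.\<close>

definition definable :: "((nat \<Rightarrow> real ^ 'n) \<Rightarrow> bool) \<Rightarrow> bool" where
  "definable \<phi> \<longleftrightarrow> (\<exists>B. finite B \<and> (\<forall>b\<in>B. env_poly b) \<and>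
     (\<forall>e e'. (\<forall>b\<in>B. sgn (b e) = sgn (b e')) \<longrightarrow> \<phi> e = \<phi> e'))"

section \<open>Closure properties of definable predicates\<close>

lemma definable_pos: "env_poly b \<Longrightarrow> definable (\<lambda>e. b e > 0)"
  unfolding definable_def by (intro exI[of _ "{b}"]) (auto simp: sgn_real_def split: if_splits)

lemma definable_not: "definable \<phi> \<Longrightarrow> definable (\<lambda>e. \<not> \<phi> e)"
  unfolding definable_def by auto

lemma definable_conj:
  assumes "definable \<phi>" "definable \<psi>"
  shows "definable (\<lambda>e. \<phi> e \<and> \<psi> e)"
proof -
  obtain B C where B: "finite B" "\<forall>b\<in>B. env_poly b"
      "\<And>e e'. (\<forall>b\<in>B. sgn (b e) = sgn (b e')) \<Longrightarrow> \<phi> e = \<phi> e'"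
    and C: "finite C" "\<forall>b\<in>C. env_poly b"
      "\<And>e e'. (\<forall>b\<in>C. sgn (b e) = sgn (b e')) \<Longrightarrow> \<psi> e = \<psi> e'"
    using assms unfolding definable_def by blast
  show ?thesis
    unfolding definable_def
  proof (intro exI[of _ "B \<union> C"] conjI allI impI)
    show "finite (B \<union> C)" "\<forall>b\<in>B \<union> C. env_poly b" using B C by auto
    fix e e' assume "\<forall>b\<in>B \<union> C. sgn (b e) = sgn (b e')"
    then show "(\<phi> e \<and> \<psi> e) = (\<phi> e' \<and> \<psi> e')" using B(3)[of e e'] C(3)[of e e'] by simp
  qed
qed

lemma definable_disj: "definable \<phi> \<Longrightarrow> definable \<psi> \<Longrightarrow> definable (\<lambda>e. \<phi> e \<or> \<psi> e)"
  using definable_not[OF definable_conj[OF definable_not[of \<phi>] definable_not[of \<psi>]]] by simp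

lemma definable_imp: "definable \<phi> \<Longrightarrow> definable \<psi> \<Longrightarrow> definable (\<lambda>e. \<phi> e \<longrightarrow> \<psi> e)"
  unfolding imp_conv_disj by (rule definable_disj[OF definable_not])

lemma definable_const: "definable (\<lambda>e. c)"
  unfolding definable_def by (rule exI[of _ "{}"]) simp

lemma definable_le:
  assumes "env_poly f" "env_poly g"
  shows "definable (\<lambda>e. f e \<le> g e)"
  using definable_not[OF definable_pos[OF env_poly_diff[OF assms]]] by (simp add: not_less)

lemma definable_ball:
  "finite P \<Longrightarrow> (\<And>f. f \<in> P \<Longrightarrow> definable (\<phi> f)) \<Longrightarrow> definable (\<lambda>e. \<forall>f\<in>P. \<phi> f e)"
  by (induction P rule: finite_induct) (auto intro: definable_const definable_conj)

lemma definable_bex: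
  "finite P \<Longrightarrow> (\<And>f. f \<in> P \<Longrightarrow> definable (\<phi> f)) \<Longrightarrow> definable (\<lambda>e. \<exists>f\<in>P. \<phi> f e)"
  by (induction P rule: finite_induct) (auto intro: definable_const definable_disj)

text \<open>Quantifiers range over vectors, but the elimination step treats one real unknown; hence
  the update of a single coordinate.\<close>

definition upd_coord :: "nat \<Rightarrow> 'n \<Rightarrow> real \<Rightarrow> (nat \<Rightarrow> real ^ 'n) \<Rightarrow> (nat \<Rightarrow> real ^ 'n)" where
  "upd_coord k i t e = e(k := (\<chi> j. if j = i then t else e k $ j))"

lemma env_poly_upd_coord:
  assumes "env_poly b"
  shows "\<exists>d P. param_poly d P \<and> (\<forall>e t. poly (P e) t = b (upd_coord k i t e))"
  using assms
proof induction
  case (env_poly_const c)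
  then show ?case
    by (intro exI[of _ 0] exI[of _ "\<lambda>e. [:c:]"])
      (auto simp: param_poly_def coeff_pCons intro!: env_poly.env_poly_const split: nat.split)
next
  case (env_poly_coord k' i')
  show ?case
  proof (cases "k' = k \<and> i' = i")
    case True
    then show ?thesis
      by (intro exI[of _ 1] exI[of _ "\<lambda>e. [:0, 1:]"])
        (auto simp: param_poly_def upd_coord_def intro!: env_poly.env_poly_const)
  next
    case False
    have "env_poly (\<lambda>e. coeff [:e k' $ i':] j)" for j
      by (cases j) (auto intro: env_poly.intros)
    with False show ?thesis
      by (intro exI[of _ 0] exI[of _ "\<lambda>e. [:e k' $ i':]"])
        (auto simp: param_poly_def upd_coord_def)
  qed
next
  case (env_poly_add f g)
  then obtain d P d' Q where P: "param_poly d P" "\<And>e t. poly (P e) t = f (upd_coord k i t e)"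
    and Q: "param_poly d' Q" "\<And>e t. poly (Q e) t = g (upd_coord k i t e)" by blast
  have "param_poly (max d d') (\<lambda>e. P e + Q e)"
    using P(1) Q(1) unfolding param_poly_def
    by (auto intro!: env_poly.env_poly_add degree_add_le intro: le_max_iff_disj[THEN iffD2])
  then show ?case using P Q by (intro exI[of _ "max d d'"] exI[of _ "\<lambda>e. P e + Q e"]) simp
next
  case (env_poly_mult f g)
  then obtain d P d' Q where P: "param_poly d P" "\<And>e t. poly (P e) t = f (upd_coord k i t e)"
    and Q: "param_poly d' Q" "\<And>e t. poly (Q e) t = g (upd_coord k i t e)" by blast
  have "param_poly (d + d') (\<lambda>e. P e * Q e)"
    using P(1) Q(1) unfolding param_poly_def
    by (auto simp: coeff_mult intro!: env_poly_sum env_poly.env_poly_mult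
        order_trans[OF degree_mult_le] add_mono)
  then show ?case using P Q by (intro exI[of _ "d + d'"] exI[of _ "\<lambda>e. P e * Q e"]) simp
qed

text \<open>A witness \<open>t\<close> over \<open>e\<close> has a counterpart \<open>t'\<close>
  over \<open>e'\<close> giving equal signs to all polynomials that decide \<open>\<phi>\<close>, so
  it is a witness too. The situation is symmetric in \<open>e\<close> and \<open>e'\<close>.\<close>

lemma definable_ex_coord:
  assumes "definable \<phi>"
  shows "definable (\<lambda>e. \<exists>t. \<phi> (upd_coord k i t e))"
proof -
  obtain B where B: "finite B" "\<forall>b\<in>B. env_poly b"
      "\<And>e e'. (\<forall>b\<in>B. sgn (b e) = sgn (b e')) \<Longrightarrow> \<phi> e = \<phi> e'"
    using assms unfolding definable_def by blast
  obtain D P where DP: "\<And>b. b \<in> B \<Longrightarrow> param_poly (D b) (P b)"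
    "\<And>b e t. b \<in> B \<Longrightarrow> poly (P b e) t = b (upd_coord k i t e)"
  proof -
    have "\<forall>b\<in>B. \<exists>dP. param_poly (fst dP) (snd dP) \<and>
        (\<forall>e t. poly (snd dP e) t = b (upd_coord k i t e))"
      using env_poly_upd_coord[of _ k i] B(2) by fastforce
    then obtain h where "\<forall>b\<in>B. param_poly (fst (h b)) (snd (h b)) \<and>
        (\<forall>e t. poly (snd (h b) e) t = b (upd_coord k i t e))"
      by (rule bchoice[THEN exE])
    then show ?thesis by (intro that[of "fst \<circ> h" "snd \<circ> h"]) auto
  qed
  let ?F = "(\<lambda>b. (D b, P b)) ` B"
  obtain C where C: "finite C" "\<forall>b\<in>C. env_poly b"
    "\<And>e e' t. (\<forall>b\<in>C. sgn (b e) = sgn (b e')) \<Longrightarrow>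
       \<exists>t'. \<forall>d P. (d, P) \<in> ?F \<longrightarrow> sgn (poly (P e) t) = sgn (poly (P e') t')"
  proof -
    have "finite ?F" "\<And>d P. (d, P) \<in> ?F \<Longrightarrow> param_poly d P" using B(1) DP(1) by auto
    from quantifier_elimination_step[OF this] obtain C where C: "finite C" "\<forall>b\<in>C. env_poly b"
      "\<forall>e e'. (\<forall>b\<in>C. sgn (b e) = sgn (b e')) \<longrightarrow>
       (\<forall>t. \<exists>t'. \<forall>d P. (d, P) \<in> ?F \<longrightarrow> sgn (poly (P e) t) = sgn (poly (P e') t'))" by blast
    show ?thesis by (rule that[OF C(1,2)]) (use C(3) in simp)
  qed
  have imp: "\<exists>t. \<phi> (upd_coord k i t e')"
    if C': "\<forall>b\<in>C. sgn (b e) = sgn (b e')" and t: "\<phi> (upd_coord k i t e)" for e e' t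
  proof -
    obtain t' where t': "\<forall>d P. (d, P) \<in> ?F \<longrightarrow> sgn (poly (P e) t) = sgn (poly (P e') t')"
      using C(3)[OF C'] by blast
    have "sgn (b (upd_coord k i t e)) = sgn (b (upd_coord k i t' e'))" if "b \<in> B" for b
      using t' that DP(2)[OF that] by force
    then have "\<phi> (upd_coord k i t' e')" using B(3)[of "upd_coord k i t e" "upd_coord k i t' e'"] t by blast
    then show ?thesis by blast
  qed
  show ?thesis
    unfolding definable_def
  proof (intro exI[of _ C] conjI allI impI C(1,2))
    fix e e' assume "\<forall>b\<in>C. sgn (b e) = sgn (b e')"
    then show "(\<exists>t. \<phi> (upd_coord k i t e)) = (\<exists>t. \<phi> (upd_coord k i t e'))"
      using imp[of e e'] imp[of e' e] by auto
  qed
qed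

text \<open>Induction on the set \<open>I\<close> of coordinates in which \<open>v\<close> may
  differ from \<open>e k\<close>: no freedom at the empty set, the full quantifier at
  \<open>UNIV\<close>, and one coordinate quantifier per step.\<close>

lemma definable_ex:
  assumes "definable \<phi>"
  shows "definable (\<lambda>e. \<exists>v. \<phi> (e(k := v)))"
proof -
  have "definable (\<lambda>e. \<exists>v. (\<forall>j. j \<notin> I \<longrightarrow> v $ j = e k $ j) \<and> \<phi> (e(k := v)))" for I
  proof (induction I rule: finite_induct[OF finite])
    case 1
    have "(\<exists>v. (\<forall>j. j \<notin> {} \<longrightarrow> v $ j = e k $ j) \<and> \<phi> (e(k := v))) \<longleftrightarrow> \<phi> e" for e
      by (auto simp flip: vec_eq_iff)
    then have "(\<lambda>e. \<exists>v. (\<forall>j. j \<notin> {} \<longrightarrow> v $ j = e k $ j) \<and> \<phi> (e(k := v))) = \<phi>" by (rule ext)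
    then show ?case using assms by metis
  next
    case (2 i I)
    have "(\<exists>v. (\<forall>j. j \<notin> insert i I \<longrightarrow> v $ j = e k $ j) \<and> \<phi> (e(k := v))) \<longleftrightarrow>
      (\<exists>t v. (\<forall>j. j \<notin> I \<longrightarrow> v $ j = upd_coord k i t e k $ j) \<and> \<phi> ((upd_coord k i t e)(k := v)))"
      for e
    proof -
      have upd: "(upd_coord k i t e)(k := v) = e(k := v)" for t v
        by (simp add: upd_coord_def)
      have "(\<forall>j. j \<notin> insert i I \<longrightarrow> v $ j = e k $ j) \<longleftrightarrow>
          (\<exists>t. \<forall>j. j \<notin> I \<longrightarrow> v $ j = upd_coord k i t e k $ j)" for v
        using 2(2) by (auto simp: upd_coord_def)
      then show ?thesis unfolding upd by blast
    qed
    then show ?case using definable_ex_coord[OF 2(3), of k i] by (simp only:)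
  qed
  from this[of UNIV] show ?thesis by simp
qed

lemma definable_all:
  assumes "definable \<phi>"
  shows "definable (\<lambda>e. \<forall>v. \<phi> (e(k := v)))"
  using definable_not[OF definable_ex[OF definable_not[OF assms]]] by simp

section \<open>Growth of roots of bivariate polynomials\<close>

lemma poly_bounded_unit_interval:
  fixes p :: "real poly"
  shows "\<exists>M. \<forall>s\<in>{0..1}. \<bar>poly p s\<bar> \<le> M"
proof -
  have "bounded (poly p ` {0..1})"
    by (intro compact_imp_bounded compact_continuous_image continuous_intros) auto
  then show ?thesis by (auto simp: bounded_iff)
qed

text \<open>A polynomial in \<open>(t, s)\<close> is encoded with outer variable \<open>t\<close>
  and coefficients in \<open>s\<close>; evaluation at \<open>[:t:]\<close> leaves a polynomial in
  \<open>s\<close>.\<close>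

lemma bipoly_bounded_unit_square:
  fixes Q :: "real poly poly"
  shows "\<exists>M. \<forall>t\<in>{0..1}. \<forall>s\<in>{0..1}. \<bar>poly (poly Q [:t:]) s\<bar> \<le> M"
proof (induction Q)
  case 0
  then show ?case by auto
next
  case (pCons a Q)
  then obtain M where M: "\<And>t s. t \<in> {0..1} \<Longrightarrow> s \<in> {0..1} \<Longrightarrow> \<bar>poly (poly Q [:t:]) s\<bar> \<le> M" by blast
  obtain K where K: "\<And>s. s \<in> {0..1} \<Longrightarrow> \<bar>poly a s\<bar> \<le> K"
    using poly_bounded_unit_interval by blast
  have "\<bar>poly (poly (pCons a Q) [:t:]) s\<bar> \<le> K + M" if h: "t \<in> {0..1}" "s \<in> {0..1}" for t s
  proof -
    have "\<bar>t * poly (poly Q [:t:]) s\<bar> \<le> 1 * M"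
      unfolding abs_mult using h M[OF h] by (intro mult_mono) auto
    then show ?thesis using K[OF h(2)] by simp
  qed
  then show ?case by blast
qed

text \<open>After removing powers of \<open>t\<close>, a nonzero polynomial restricts to \<open>s\<^sup>N c\<^sub>1(s)\<close> on \<open>t = 0\<close> with
  \<open>c\<^sub>1(0) \<noteq> 0\<close>; this replaces Puiseux expansions of the branches through the origin.\<close>

lemma bipoly_root_bound:
  fixes Q :: "real poly poly"
  assumes "Q \<noteq> 0"
  shows "\<exists>N C r. 0 < r \<and> r \<le> 1 \<and> (\<forall>t s. 0 < t \<longrightarrow> t \<le> r \<longrightarrow> 0 < s \<longrightarrow> s \<le> r \<longrightarrow>
    poly (poly Q [:t:]) s = 0 \<longrightarrow> s ^ N \<le> C * t)"
proof -
  obtain Q1 where Q1: "Q = [:- 0, 1:] ^ order 0 Q * Q1" "\<not> [:- 0, 1:] dvd Q1"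
    using order_decomp[OF assms] by blast
  obtain c Q2 where cQ: "Q1 = pCons c Q2" by (cases Q1)
  have "poly Q1 0 \<noteq> 0" using Q1(2) by (simp add: poly_eq_0_iff_dvd)
  then have "c \<noteq> 0" using cQ by simp
  then obtain c1 where c1: "c = [:- 0, 1:] ^ order 0 c * c1" "\<not> [:- 0, 1:] dvd c1"
    using order_decomp by blast
  define N where "N = order 0 c"
  have c10: "poly c1 0 \<noteq> 0" using c1(2) by (simp add: poly_eq_0_iff_dvd)
  obtain M where M: "\<And>t s. t \<in> {0..1} \<Longrightarrow> s \<in> {0..1} \<Longrightarrow> \<bar>poly (poly Q2 [:t:]) s\<bar> \<le> M"
    using bipoly_bounded_unit_square by blast
  define d where "d = \<bar>poly c1 0\<bar> / 2"
  have d: "d > 0" using c10 by (simp add: d_def)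
  have "isCont (\<lambda>s. \<bar>poly c1 s\<bar>) 0" by (intro continuous_intros)
  then have "((\<lambda>s. \<bar>poly c1 s\<bar>) \<longlongrightarrow> \<bar>poly c1 0\<bar>) (nhds 0)"
    by (simp add: isCont_def tendsto_nhds_iff)
  then have "\<forall>\<^sub>F s in nhds 0. d < \<bar>poly c1 s\<bar>"
    by (rule order_tendstoD(1)) (use c10 in \<open>simp add: d_def\<close>)
  then obtain r0 where r0: "r0 > 0" "\<And>s. \<bar>s\<bar> < r0 \<Longrightarrow> d < \<bar>poly c1 s\<bar>"
    unfolding eventually_nhds_metric by (auto simp: dist_real_def)
  define r where "r = min 1 (r0 / 2)"
  have r: "0 < r" "r \<le> 1" "r < r0" using r0 by (auto simp: r_def min_def)
  have "s ^ N \<le> M / d * t"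
    if h: "0 < t" "t \<le> r" "0 < s" "s \<le> r" "poly (poly Q [:t:]) s = 0" for t s
  proof -
    \<comment> \<open>As \<open>t\<close> is positive, the extracted power of \<open>t\<close> can
      be cancelled at a root, leaving \<open>c(s) = - t Q2(t, s)\<close> with \<open>Q2\<close>
      bounded.\<close>
    have "poly (poly Q [:t:]) s = t ^ order 0 Q * (poly c s + t * poly (poly Q2 [:t:]) s)"
      by (subst Q1(1)) (simp add: cQ algebra_simps)
    then have "poly c s = - (t * poly (poly Q2 [:t:]) s)"
      using h by (simp add: add_eq_0_iff)
    moreover have "poly c s = s ^ N * poly c1 s"
      by (subst c1(1)) (simp add: N_def)
    ultimately have "s ^ N * \<bar>poly c1 s\<bar> = t * \<bar>poly (poly Q2 [:t:]) s\<bar>"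
      using h by (metis abs_minus_cancel abs_mult abs_of_pos zero_less_power)
    also have "\<dots> \<le> t * M" using M[of t s] h r by (intro mult_left_mono) auto
    finally have "s ^ N * \<bar>poly c1 s\<bar> \<le> t * M" .
    moreover have "s ^ N * d \<le> s ^ N * \<bar>poly c1 s\<bar>"
      using r0(2)[of s] h r by (intro mult_left_mono) auto
    ultimately show ?thesis using d by (simp add: field_simps)
  qed
  then show ?thesis using r by blast
qed

text \<open>For \<open>s\<close> at most 1 a larger exponent only weakens the bound, so the
  exponents are added and the maximum of the constants is taken.\<close>

lemma bipolys_root_bound:
  fixes F :: "real poly poly set"
  assumes "finite F" "0 \<notin> F"
  shows "\<exists>N C r. 0 < r \<and> r \<le> 1 \<and> N \<ge> 1 \<and> C \<ge> 0 \<and> (\<forall>Q\<in>F. \<forall>t s. 0 < t \<longrightarrow> t \<le> r \<longrightarrow> 0 < s \<longrightarrow> s \<le> r \<longrightarrow>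
    poly (poly Q [:t:]) s = 0 \<longrightarrow> s ^ N \<le> C * t)"
  using assms
proof (induction F)
  case empty
  show ?case by (intro exI[of _ 1] exI[of _ 0]) auto
next
  case (insert Q F)
  obtain N C r where 1: "0 < r" "r \<le> 1" "N \<ge> 1" "C \<ge> 0" "\<And>Q t s. Q \<in> F \<Longrightarrow> 0 < t \<Longrightarrow> t \<le> r \<Longrightarrow>
      0 < s \<Longrightarrow> s \<le> r \<Longrightarrow> poly (poly Q [:t:]) s = 0 \<Longrightarrow> s ^ N \<le> C * t"
    using insert by auto
  obtain N' C' r' where 2: "0 < r'" "r' \<le> 1" "\<forall>t s. 0 < t \<longrightarrow> t \<le> r' \<longrightarrow> 0 < s \<longrightarrow> s \<le> r' \<longrightarrow>
      poly (poly Q [:t:]) s = 0 \<longrightarrow> s ^ N' \<le> C' * t"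
  proof -
    have "Q \<noteq> 0" using insert.prems by auto
    from bipoly_root_bound[OF this] show ?thesis by (elim exE conjE) (rule that)
  qed
  have "s ^ (N + N') \<le> max C C' * t"
    if h: "P \<in> insert Q F" "0 < t" "t \<le> min r r'" "0 < s" "s \<le> min r r'"
      "poly (poly P [:t:]) s = 0" for P t s
  proof -
    have s1: "s \<le> 1" using h 1 by simp
    have "s ^ (N + N') \<le> s ^ N" "s ^ (N + N') \<le> s ^ N'"
      using h s1 by (auto intro!: power_decreasing)
    moreover have "C * t \<le> max C C' * t" "C' * t \<le> max C C' * t"
      using h by (auto intro!: mult_right_mono)
    moreover have "s ^ N \<le> C * t \<or> s ^ N' \<le> C' * t"
      using 1(5)[of P t s] 2(3) h by auto
    ultimately show ?thesis by linarith
  qed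
  then show ?case
    using 1 2 by (intro exI[of _ "N + N'"] exI[of _ "max C C'"] exI[of _ "min r r'"]) auto
qed

text \<open>For fixed \<open>t\<close> the values \<open>s\<close> satisfying \<open>\<psi>\<close>
  form a half-line with supremum \<open>h\<close>. At \<open>h\<close> some polynomial that is
  nonzero after specialising \<open>t\<close> must vanish, for otherwise all signs, hence
  \<open>\<psi>\<close>, would be constant near \<open>h\<close>. The root bound for
  \<open>h\<close> is inherited by every smaller positive \<open>s\<close>.\<close>

lemma sign_invariant_growth:
  fixes F :: "real poly poly set" and \<psi> :: "real \<Rightarrow> real \<Rightarrow> bool"
  assumes F: "finite F" "\<And>t s t' s'. (\<And>Q. Q \<in> F \<Longrightarrow>
      sgn (poly (poly Q [:t:]) s) = sgn (poly (poly Q [:t':]) s')) \<Longrightarrow> \<psi> t s = \<psi> t' s'"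
    and down: "\<And>t s s'. \<psi> t s \<Longrightarrow> s' \<le> s \<Longrightarrow> \<psi> t s'"
    and lim: "\<And>\<epsilon>. \<epsilon> > 0 \<Longrightarrow> \<exists>\<delta>>0. \<forall>t s. 0 < t \<longrightarrow> t < \<delta> \<longrightarrow> \<psi> t s \<longrightarrow> s \<le> \<epsilon>"
  shows "\<exists>N C \<delta>. N \<ge> 1 \<and> C \<ge> 0 \<and> \<delta> > 0 \<and>
    (\<forall>t s. 0 < t \<longrightarrow> t < \<delta> \<longrightarrow> 0 < s \<longrightarrow> \<psi> t s \<longrightarrow> s ^ N \<le> C * t)"
proof -
  obtain N C r where r: "0 < r" "N \<ge> 1" "C \<ge> 0" and root: "\<And>Q t s. Q \<in> F - {0} \<Longrightarrow> 0 < t \<Longrightarrow> t \<le> r \<Longrightarrow>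
      0 < s \<Longrightarrow> s \<le> r \<Longrightarrow> poly (poly Q [:t:]) s = 0 \<Longrightarrow> s ^ N \<le> C * t"
    using bipolys_root_bound[of "F - {0}"] F(1) by auto
  obtain \<delta> where \<delta>: "\<delta> > 0" "\<And>t s. 0 < t \<Longrightarrow> t < \<delta> \<Longrightarrow> \<psi> t s \<Longrightarrow> s \<le> r"
    using lim[OF r(1)] by blast
  have "s ^ N \<le> C * t" if h: "0 < t" "t < min \<delta> r" "0 < s" "\<psi> t s" for t s
  proof -
    define h where "h = Sup {s. \<psi> t s}"
    have ne: "{s. \<psi> t s} \<noteq> {}" using h by blast
    have bdd: "bdd_above {s. \<psi> t s}" using \<delta>(2)[of t] h by (auto simp: bdd_above_def)
    have sh: "s \<le> h" unfolding h_def using h bdd by (intro cSup_upper) auto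
    have hr: "h \<le> r" unfolding h_def using ne \<delta>(2)[of t] h by (intro cSup_least) auto
    have "\<exists>Q\<in>F. poly Q [:t:] \<noteq> 0 \<and> poly (poly Q [:t:]) h = 0"
    proof (rule ccontr)
      assume none: "\<not> ?thesis"
      have "\<forall>\<^sub>F x in nhds h. sgn (poly (poly Q [:t:]) x) = sgn (poly (poly Q [:t:]) h)"
        if "Q \<in> F" for Q
      proof (cases "poly Q [:t:] = 0")
        case False
        then have nz: "poly (poly Q [:t:]) h \<noteq> 0" using none that by blast
        have "isCont (poly (poly Q [:t:])) h" by simp
        then have tend: "(poly (poly Q [:t:]) \<longlongrightarrow> poly (poly Q [:t:]) h) (nhds h)"
          by (simp add: isCont_def tendsto_nhds_iff)
        show ?thesis
        proof (cases "poly (poly Q [:t:]) h > 0")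
          case True
          show ?thesis
            by (rule eventually_mono[OF order_tendstoD(1)[OF tend True]]) (use True in simp)
        next
          case False
          then have neg: "poly (poly Q [:t:]) h < 0" using nz by simp
          show ?thesis
            by (rule eventually_mono[OF order_tendstoD(2)[OF tend neg]]) (use neg in simp)
        qed
      qed simp
      then have "\<forall>\<^sub>F x in nhds h. \<forall>Q\<in>F. sgn (poly (poly Q [:t:]) x) = sgn (poly (poly Q [:t:]) h)"
        using F(1) by (intro eventually_ball_finite) auto
      then obtain d where d: "d > 0" "\<And>x Q. \<bar>x - h\<bar> < d \<Longrightarrow> Q \<in> F \<Longrightarrow>
          sgn (poly (poly Q [:t:]) x) = sgn (poly (poly Q [:t:]) h)"
        unfolding eventually_nhds_metric by (auto simp: dist_real_def)
      have same: "\<psi> t x = \<psi> t h" if "\<bar>x - h\<bar> < d" for x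
        by (rule F(2)) (rule d(2)[OF that])
      have "h - d / 2 < Sup {s. \<psi> t s}" using d h_def by simp
      then obtain y where "\<psi> t y" "h - d / 2 < y"
        using less_cSupE[OF _ ne] by blast
      then have "\<psi> t (h - d / 2)" using down by (meson less_imp_le)
      \<comment> \<open>Local constancy carries \<open>\<psi>\<close> from just below the supremum
        to just above it.\<close>
      then have "\<psi> t (h + d / 2)" using same[of "h - d / 2"] same[of "h + d / 2"] d by simp
      then have "h + d / 2 \<le> h"
        unfolding h_def using bdd by (intro cSup_upper) auto
      then show False using d by simp
    qed
    then obtain Q where Q: "Q \<in> F" "poly Q [:t:] \<noteq> 0" "poly (poly Q [:t:]) h = 0" by blast
    then have "Q \<in> F - {0}" by auto
    then have "h ^ N \<le> C * t" using root[of Q t h] Q h sh hr \<open>0 < s\<close> by auto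
    moreover have "s ^ N \<le> h ^ N" using sh \<open>0 < s\<close> by (intro power_mono) auto
    ultimately show ?thesis by linarith
  qed
  then show ?thesis using r \<delta>(1) by (intro exI[of _ N] exI[of _ C] exI[of _ "min \<delta> r"]) auto
qed

text \<open>Two scalars are passed to the vector-valued environment as constant vectors,
  \<open>t\<close> in variable 0 and \<open>s\<close> in all others.\<close>

lemma env_poly_bipoly:
  assumes "env_poly b"
  shows "\<exists>Q. \<forall>t s. b (\<lambda>k. if k = 0 then vec t else vec s) = poly (poly Q [:t:]) s"
  using assms
proof induction
  case (env_poly_const c)
  then show ?case by (intro exI[of _ "[:[:c:]:]"]) simp
next
  case (env_poly_coord k i)
  then show ?case
    by (cases "k = 0") (auto intro: exI[of _ "[:0, 1:]"] exI[of _ "[:[:0, 1:]:]"])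
next
  case (env_poly_add f g)
  then obtain P Q where "\<And>t s. f (\<lambda>k. if k = 0 then vec t else vec s) = poly (poly P [:t:]) s"
    "\<And>t s. g (\<lambda>k. if k = 0 then vec t else vec s) = poly (poly Q [:t:]) s" by blast
  then show ?case by (intro exI[of _ "P + Q"]) simp
next
  case (env_poly_mult f g)
  then obtain P Q where "\<And>t s. f (\<lambda>k. if k = 0 then vec t else vec s) = poly (poly P [:t:]) s"
    "\<And>t s. g (\<lambda>k. if k = 0 then vec t else vec s) = poly (poly Q [:t:]) s" by blast
  then show ?case by (intro exI[of _ "P * Q"]) simp
qed

lemma definable_bipolys:
  assumes "definable \<phi>"
  shows "\<exists>F :: real poly poly set. finite F \<and> (\<forall>t s t' s'.
    (\<forall>Q\<in>F. sgn (poly (poly Q [:t:]) s) = sgn (poly (poly Q [:t':]) s')) \<longrightarrow>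
    \<phi> (\<lambda>k. if k = 0 then vec t else vec s) = \<phi> (\<lambda>k. if k = 0 then vec t' else vec s'))"
proof -
  obtain B where B: "finite B" "\<forall>b\<in>B. env_poly b"
      "\<And>e e'. (\<forall>b\<in>B. sgn (b e) = sgn (b e')) \<Longrightarrow> \<phi> e = \<phi> e'"
    using assms unfolding definable_def by blast
  have "\<forall>b\<in>B. \<exists>Q. \<forall>t s. b (\<lambda>k. if k = 0 then vec t else vec s) = poly (poly Q [:t:]) s"
    using env_poly_bipoly B(2) by blast
  then obtain q where q: "\<forall>b\<in>B. \<forall>t s. b (\<lambda>k. if k = 0 then vec t else vec s) = poly (poly (q b) [:t:]) s"
    by (rule bchoice[THEN exE])
  show ?thesis
  proof (intro exI[of _ "q ` B"] conjI allI impI)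
    show "finite (q ` B)" using B(1) by simp
    fix t s t' s'
    assume "\<forall>Q\<in>q ` B. sgn (poly (poly Q [:t:]) s) = sgn (poly (poly Q [:t':]) s')"
    then show "\<phi> (\<lambda>k. if k = 0 then vec t else vec s) = \<phi> (\<lambda>k. if k = 0 then vec t' else vec s')"
      using q by (intro B(3)) simp
  qed
qed

section \<open>Definability of norms and of semialgebraic sets\<close>

definition env_vec :: "((nat \<Rightarrow> real ^ 'n) \<Rightarrow> real ^ 'n) \<Rightarrow> bool" where
  "env_vec f \<longleftrightarrow> (\<forall>i. env_poly (\<lambda>e. f e $ i))"

lemma env_vec_const: "env_vec (\<lambda>e. c)"
  by (simp add: env_vec_def env_poly_const)

lemma env_vec_var: "env_vec (\<lambda>e. e k)"
  by (simp add: env_vec_def env_poly_coord)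

lemma env_poly_norm_diff:
  assumes "env_vec f" "env_vec g"
  shows "env_poly (\<lambda>e. (norm (f e - g e))\<^sup>2)"
proof -
  have "env_poly (\<lambda>e. f e $ i - g e $ i)" for i
    using assms unfolding env_vec_def by (auto intro: env_poly_diff)
  then have "env_poly (\<lambda>e. \<Sum>i\<in>UNIV. (f e $ i - g e $ i) * (f e $ i - g e $ i))"
    by (intro env_poly_sum) (rule env_poly_mult)
  then show ?thesis by (simp add: power2_norm_eq_inner inner_vec_def)
qed

text \<open>The generators are arbitrary linear functionals, which are expanded in the standard
  basis.\<close>

lemma env_poly_real_polynomial_function:
  fixes p :: "real ^ 'n \<Rightarrow> real"
  assumes "real_polynomial_function p"
  shows "env_poly (\<lambda>e. p (e k))"
  using assms
proof induction
  case (linear f)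
  then have lin: "linear f" by (rule bounded_linear.linear)
  have "(\<lambda>e. f (e k)) = (\<lambda>e. \<Sum>i\<in>UNIV. e k $ i * f (axis i 1))"
  proof
    fix e :: "nat \<Rightarrow> real ^ 'n"
    define x where "x = e k"
    have "f x = f (\<Sum>i\<in>UNIV. x $ i *\<^sub>R axis i 1)"
      by (simp add: basis_expansion[of x, unfolded scalar_mult_eq_scaleR])
    also have "\<dots> = (\<Sum>i\<in>UNIV. x $ i * f (axis i 1))"
      by (simp add: linear_sum[OF lin] linear_cmul[OF lin])
    finally show "f (e k) = (\<Sum>i\<in>UNIV. e k $ i * f (axis i 1))" by (simp add: x_def)
  qed
  moreover have "env_poly (\<lambda>e. \<Sum>i\<in>UNIV. e k $ i * f (axis i 1))"
    by (intro env_poly_sum env_poly_mult env_poly_const env_poly_coord)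
  ultimately show ?case by (simp only:)
qed (auto intro: env_poly.intros)

lemma definable_semialgebraic:
  assumes "semialgebraic X"
  shows "definable (\<lambda>e. e k \<in> X)"
proof -
  obtain F where F: "finite F" "\<forall>B\<in>F. basic_semialgebraic B" "X = \<Union>F"
    using assms unfolding semialgebraic_def by blast
  have "definable (\<lambda>e. e k \<in> B)" if B: "B \<in> F" for B
  proof -
    obtain P Q where PQ: "finite P" "finite Q" "\<forall>f\<in>P \<union> Q. real_polynomial_function f"
        "B = {x. (\<forall>f\<in>P. f x = 0) \<and> (\<forall>g\<in>Q. g x > 0)}"
    proof -
      have "basic_semialgebraic B" using F(2) B by blast
      then show ?thesis unfolding basic_semialgebraic_def by (elim exE conjE) (rule that)
    qed
    have "definable (\<lambda>e. f (e k) \<le> 0 \<and> 0 \<le> f (e k))" if "f \<in> P" for f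
      using PQ(3) that
      by (intro definable_conj definable_le env_poly_const env_poly_real_polynomial_function) auto
    then have "definable (\<lambda>e. \<forall>f\<in>P. f (e k) = 0)"
      using definable_ball[OF PQ(1), of "\<lambda>f e. f (e k) = 0"] by (simp add: eq_iff)
    moreover have "definable (\<lambda>e. \<forall>g\<in>Q. g (e k) > 0)"
      using PQ(3) by (intro definable_ball PQ(2) definable_pos env_poly_real_polynomial_function) auto
    ultimately show ?thesis using definable_conj by (simp add: PQ(4))
  qed
  then have "definable (\<lambda>e. \<exists>B\<in>F. e k \<in> B)" by (intro definable_bex F(1))
  then show ?thesis by (simp add: F(3))
qed

section \<open>Nearest points\<close>

lemma definable_Ball:
  assumes "definable (\<lambda>e. e k \<in> A)" "definable \<phi>"
  shows "definable (\<lambda>e. \<forall>v\<in>A. \<phi> (e(k := v)))"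
  using definable_all[OF definable_imp[OF assms], of k] by (simp add: Ball_def)

text \<open>Replaces the distance function by a comparison with all points of \<open>X\<close>,
  which after squaring is a quantified polynomial inequality.\<close>

lemma nearest_points_iff:
  assumes "closed X" "X \<noteq> {}"
  shows "y \<in> nearest_points X a \<longleftrightarrow> y \<in> X \<and> (\<forall>z\<in>X. norm (y - a) \<le> norm (z - a))"
proof
  assume y: "y \<in> nearest_points X a"
  then show "y \<in> X \<and> (\<forall>z\<in>X. norm (y - a) \<le> norm (z - a))"
    using infdist_le[of _ X a] by (auto simp: nearest_points_def dist_norm norm_minus_commute)
next
  assume y: "y \<in> X \<and> (\<forall>z\<in>X. norm (y - a) \<le> norm (z - a))"
  obtain z where z: "z \<in> X" "infdist a X = dist a z"
    using infdist_attains_inf[OF assms] by blast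
  have "infdist a X \<le> norm (y - a)"
    using infdist_le[of y X a] y by (simp add: dist_norm norm_minus_commute)
  moreover have "norm (y - a) \<le> infdist a X"
    using y z by (metis dist_norm norm_minus_commute)
  ultimately show "y \<in> nearest_points X a"
    using y by (simp add: nearest_points_def)
qed

lemma definable_nearest_points:
  assumes "closed X" "X \<noteq> {}" "\<And>k. definable (\<lambda>e. e k \<in> X)"
  shows "definable (\<lambda>e. e k \<in> nearest_points X a)"
proof -
  have "definable (\<lambda>e. (norm (e k - a))\<^sup>2 \<le> (norm (e (Suc k) - a))\<^sup>2)"
    by (intro definable_le env_poly_norm_diff env_vec_var env_vec_const)
  then have "definable (\<lambda>e. \<forall>z\<in>X. (norm (e k - a))\<^sup>2 \<le> (norm (z - a))\<^sup>2)"
    using definable_Ball[OF assms(3)[of "Suc k"], of "\<lambda>e. (norm (e k - a))\<^sup>2 \<le> (norm (e (Suc k) - a))\<^sup>2"]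
    by simp
  from definable_conj[OF assms(3)[of k] this] show ?thesis
    by (simp add: nearest_points_iff[OF assms(1,2)] power2_le_iff_abs_le)
qed

section \<open>Intersections of Voronoi cells and the defect inequality\<close>

definition voronoi :: "(real ^ 'n) set \<Rightarrow> (real ^ 'n) set \<Rightarrow> (real ^ 'n) set" where
  "voronoi M X = {y. \<forall>b\<in>M. \<forall>z\<in>X. norm (y - b) \<le> norm (y - z)}"

lemma voronoi_nearest_points:
  assumes "closed X" "X \<noteq> {}"
  shows "{y. nearest_points X a \<subseteq> nearest_points X y} = voronoi (nearest_points X a) X"
  unfolding voronoi_def
  by (auto simp: nearest_points_iff[OF assms] subset_eq norm_minus_commute)

lemma definable_voronoi:
  assumes M: "\<And>k. definable (\<lambda>e. e k \<in> M)" and X: "\<And>k. definable (\<lambda>e. e k \<in> X)"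
  shows "definable (\<lambda>e. e k \<in> voronoi M X)"
proof -
  have "definable (\<lambda>e. (norm (e k - e (Suc k)))\<^sup>2 \<le> (norm (e k - e (Suc (Suc k))))\<^sup>2)"
    by (intro definable_le env_poly_norm_diff env_vec_var)
  from definable_Ball[OF X[of "Suc (Suc k)"] this]
  have "definable (\<lambda>e. \<forall>z\<in>X. (norm (e k - e (Suc k)))\<^sup>2 \<le> (norm (e k - z))\<^sup>2)" by simp
  from definable_Ball[OF M[of "Suc k"] this] show ?thesis
    by (simp add: voronoi_def power2_le_iff_abs_le)
qed

text \<open>Otherwise a bounded sequence has defects tending to 0 while its squared distances to the
  cell exceed \<open>\<epsilon>\<close>. A limit point has defect 0, so it lies in the cell, a
  contradiction.\<close>

lemma voronoi_defect_limit:
  assumes "\<epsilon> > 0"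
  shows "\<exists>\<delta>>0. \<forall>x t s. norm (x - a) \<le> R \<longrightarrow> 0 < t \<longrightarrow> t < \<delta> \<longrightarrow>
    (\<forall>b\<in>M. \<forall>z\<in>X. (norm (x - b))\<^sup>2 \<le> (norm (x - z))\<^sup>2 + t) \<longrightarrow>
    (\<forall>y\<in>voronoi M X. s \<le> (norm (x - y))\<^sup>2) \<longrightarrow> s \<le> \<epsilon>"
proof (rule ccontr)
  assume "\<not> ?thesis"
  then have "\<exists>x t s. norm (x - a) \<le> R \<and> 0 < t \<and> t < 1 / real (Suc n) \<and>
    (\<forall>b\<in>M. \<forall>z\<in>X. (norm (x - b))\<^sup>2 \<le> (norm (x - z))\<^sup>2 + t) \<and>
    (\<forall>y\<in>voronoi M X. s \<le> (norm (x - y))\<^sup>2) \<and> \<not> s \<le> \<epsilon>" for n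
    by (metis of_nat_0_less_iff zero_less_Suc zero_less_divide_1_iff)
  then obtain x t s where xts: "\<And>n. norm (x n - a) \<le> R" "\<And>n. 0 < t n" "\<And>n. t n < 1 / real (Suc n)"
    "\<And>n b z. b \<in> M \<Longrightarrow> z \<in> X \<Longrightarrow> (norm (x n - b))\<^sup>2 \<le> (norm (x n - z))\<^sup>2 + t n"
    "\<And>n y. y \<in> voronoi M X \<Longrightarrow> s n \<le> (norm (x n - y))\<^sup>2" "\<And>n. \<epsilon> < s n"
    by (metis not_le)
  have "\<forall>n. x n \<in> cball a R" using xts(1) by (simp add: dist_norm norm_minus_commute)
  then obtain l r where r: "strict_mono (r :: nat \<Rightarrow> nat)" "(x \<circ> r) \<longlonglongrightarrow> l"
    using compact_cball[of a R] unfolding compact_def by blast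
  have tr: "(\<lambda>n. t (r n)) \<longlonglongrightarrow> 0"
  proof (rule tendsto_sandwich[of "\<lambda>_. 0" _ _ "\<lambda>n. 1 / real (Suc n)"])
    show "\<forall>\<^sub>F n in sequentially. t (r n) \<le> 1 / real (Suc n)"
    proof (intro always_eventually allI)
      fix n
      have "t (r n) \<le> 1 / real (Suc (r n))" using xts(3) less_imp_le by blast
      also have "\<dots> \<le> 1 / real (Suc n)"
        using seq_suble[OF r(1), of n] by (intro divide_left_mono) auto
      finally show "t (r n) \<le> 1 / real (Suc n)" .
    qed
    show "(\<lambda>n. 1 / real (Suc n)) \<longlonglongrightarrow> 0"
      using LIMSEQ_inverse_real_of_nat by (simp add: inverse_eq_divide)
  qed (use xts(2) in \<open>auto intro!: always_eventually less_imp_le\<close>)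
  have xr: "(\<lambda>n. x (r n)) \<longlonglongrightarrow> l" using r(2) by (simp add: o_def)
  have "l \<in> voronoi M X"
    unfolding voronoi_def
  proof (intro CollectI ballI)
    fix b z assume bz: "b \<in> M" "z \<in> X"
    have "(norm (l - b))\<^sup>2 \<le> (norm (l - z))\<^sup>2 + 0"
    proof (rule LIMSEQ_le)
      show "(\<lambda>n. (norm (x (r n) - b))\<^sup>2) \<longlonglongrightarrow> (norm (l - b))\<^sup>2"
        "(\<lambda>n. (norm (x (r n) - z))\<^sup>2 + t (r n)) \<longlonglongrightarrow> (norm (l - z))\<^sup>2 + 0"
        by (intro tendsto_intros xr tr)+
    qed (use xts(4)[OF bz] in blast)
    then show "norm (l - b) \<le> norm (l - z)" by (simp add: power2_le_iff_abs_le)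
  qed
  then have "\<epsilon> \<le> (norm (x (r n) - l))\<^sup>2" for n
    using xts(5)[of l "r n"] xts(6)[of "r n"] by linarith
  moreover have "(\<lambda>n. (norm (x (r n) - l))\<^sup>2) \<longlonglongrightarrow> (norm (l - l))\<^sup>2"
    by (intro tendsto_intros xr)
  ultimately have "\<epsilon> \<le> (norm (l - l))\<^sup>2"
    using LIMSEQ_le_const by blast
  then show False using assms by simp
qed

lemma voronoi_growth:
  fixes M X :: "(real ^ 'n) set"
  assumes M: "\<And>k. definable (\<lambda>e. e k \<in> M)" and X: "\<And>k. definable (\<lambda>e. e k \<in> X)"
  shows "\<exists>N C \<delta>. N \<ge> 1 \<and> C \<ge> 0 \<and> \<delta> > 0 \<and> (\<forall>x t. norm (x - a) \<le> R \<longrightarrow> 0 < t \<longrightarrow> t < \<delta> \<longrightarrow>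
    (\<forall>b\<in>M. \<forall>z\<in>X. (norm (x - b))\<^sup>2 \<le> (norm (x - z))\<^sup>2 + t) \<longrightarrow>
    infdist x (voronoi M X) ^ (2 * N) \<le> C * t)"
proof -
  let ?V = "voronoi M X"
  \<comment> \<open>Some \<open>x\<close> in the ball has defect at most \<open>t\<close> and
    squared distance at least \<open>s\<close> to the cell. All distances are squared to stay
    polynomial, and the universal quantifier over the cell makes the relation downward closed in
    \<open>s\<close>.\<close>
  define \<psi> where "\<psi> t s \<longleftrightarrow> (\<exists>x. (norm (x - a))\<^sup>2 \<le> R\<^sup>2 \<and>
    (\<forall>b\<in>M. \<forall>z\<in>X. (norm (x - b))\<^sup>2 \<le> (norm (x - z))\<^sup>2 + t) \<and>
    (\<forall>y\<in>?V. s \<le> (norm (x - y))\<^sup>2))" for t s :: real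
  \<comment> \<open>Any coordinate will do: \<open>t\<close> and \<open>s\<close> are read off as
    the \<open>i\<close>-th coordinates of variables 0 and 1; \<open>x\<close> is variable 2, and 3
    and 4 are bound.\<close>
  obtain i :: 'n where True by blast
  have "definable (\<lambda>e. (norm (e 2 - e 3))\<^sup>2 \<le> (norm (e 2 - e 4))\<^sup>2 + e 0 $ i)"
    by (intro definable_le env_poly_add env_poly_norm_diff env_vec_var env_poly_coord)
  from definable_Ball[OF X[of 4] this]
  have "definable (\<lambda>e. \<forall>z\<in>X. (norm (e 2 - e 3))\<^sup>2 \<le> (norm (e 2 - z))\<^sup>2 + e 0 $ i)" by simp
  from definable_Ball[OF M[of 3] this]
  have d1: "definable (\<lambda>e. \<forall>b\<in>M. \<forall>z\<in>X. (norm (e 2 - b))\<^sup>2 \<le> (norm (e 2 - z))\<^sup>2 + e 0 $ i)" by simp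
  have "definable (\<lambda>e. e 1 $ i \<le> (norm (e 2 - e 3))\<^sup>2)"
    by (intro definable_le env_poly_norm_diff env_vec_var env_poly_coord)
  from definable_Ball[OF definable_voronoi[OF M X, of 3] this]
  have d2: "definable (\<lambda>e. \<forall>y\<in>?V. e 1 $ i \<le> (norm (e 2 - y))\<^sup>2)" by simp
  have d3: "definable (\<lambda>e. (norm (e 2 - a))\<^sup>2 \<le> R\<^sup>2)"
    by (intro definable_le env_poly_norm_diff env_vec_var env_vec_const env_poly_const)
  from definable_ex[OF definable_conj[OF d3 definable_conj[OF d1 d2]], of 2]
  have "definable (\<lambda>e. \<psi> (e 0 $ i) (e 1 $ i))" by (simp add: \<psi>_def)
  from definable_bipolys[OF this] obtain F :: "real poly poly set" where
    F: "finite F" "\<And>t s t' s'. (\<And>Q. Q \<in> F \<Longrightarrow>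
      sgn (poly (poly Q [:t:]) s) = sgn (poly (poly Q [:t':]) s')) \<Longrightarrow> \<psi> t s = \<psi> t' s'"
    by auto
  define r where "r = \<bar>R\<bar>"
  have sq: "(norm (x - a))\<^sup>2 \<le> R\<^sup>2 \<longleftrightarrow> norm (x - a) \<le> r" for x
    unfolding r_def by (metis abs_le_square_iff abs_norm_cancel)
  have "\<exists>N C \<delta>. N \<ge> 1 \<and> C \<ge> 0 \<and> \<delta> > 0 \<and>
    (\<forall>t s. 0 < t \<longrightarrow> t < \<delta> \<longrightarrow> 0 < s \<longrightarrow> \<psi> t s \<longrightarrow> s ^ N \<le> C * t)"
  proof (rule sign_invariant_growth[OF F])
    show "\<psi> t s'" if "\<psi> t s" "s' \<le> s" for t s s'
      using that unfolding \<psi>_def by (meson order_trans)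
    show "\<exists>\<delta>>0. \<forall>t s. 0 < t \<longrightarrow> t < \<delta> \<longrightarrow> \<psi> t s \<longrightarrow> s \<le> \<epsilon>" if pos: "\<epsilon> > 0" for \<epsilon>
    proof -
      obtain \<delta> where "\<delta> > 0" and \<delta>: "\<forall>x t s. norm (x - a) \<le> r \<longrightarrow> 0 < t \<longrightarrow> t < \<delta> \<longrightarrow>
        (\<forall>b\<in>M. \<forall>z\<in>X. (norm (x - b))\<^sup>2 \<le> (norm (x - z))\<^sup>2 + t) \<longrightarrow>
        (\<forall>y\<in>?V. s \<le> (norm (x - y))\<^sup>2) \<longrightarrow> s \<le> \<epsilon>"
        using voronoi_defect_limit[OF pos, of a r M X] by blast
      have "s \<le> \<epsilon>" if ts: "0 < t" "t < \<delta>" "\<psi> t s" for t s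
      proof -
        obtain x where "norm (x - a) \<le> r"
          "\<forall>b\<in>M. \<forall>z\<in>X. (norm (x - b))\<^sup>2 \<le> (norm (x - z))\<^sup>2 + t"
          "\<forall>y\<in>?V. s \<le> (norm (x - y))\<^sup>2"
          using ts(3) unfolding \<psi>_def sq by blast
        with \<delta> ts(1,2) show ?thesis by simp
      qed
      with \<open>\<delta> > 0\<close> show ?thesis by blast
    qed
  qed
  then obtain N C \<delta> where N: "N \<ge> 1" "C \<ge> 0" "\<delta> > 0"
    and growth: "\<And>t s. 0 < t \<Longrightarrow> t < \<delta> \<Longrightarrow> 0 < s \<Longrightarrow> \<psi> t s \<Longrightarrow> s ^ N \<le> C * t"
    by blast
  have "infdist x ?V ^ (2 * N) \<le> C * t"
    if h: "norm (x - a) \<le> R" "0 < t" "t < \<delta>"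
      "\<forall>b\<in>M. \<forall>z\<in>X. (norm (x - b))\<^sup>2 \<le> (norm (x - z))\<^sup>2 + t" for x t
  proof (cases "infdist x ?V = 0")
    case True
    then show ?thesis using N h by (simp add: power_0_left)
  next
    case False
    have "norm (x - a) \<le> r" using h(1) by (simp add: r_def)
    moreover have "(infdist x ?V)\<^sup>2 \<le> (norm (x - y))\<^sup>2" if "y \<in> ?V" for y
      using infdist_le[OF that, of x] infdist_nonneg[of x ?V] by (simp add: dist_norm power_mono)
    ultimately have "\<psi> t ((infdist x ?V)\<^sup>2)" unfolding \<psi>_def sq using h(4) by blast
    \<comment> \<open>Here \<open>s\<close> is the squared distance, whence the exponent
      \<open>2 * N\<close>.\<close>
    then have "((infdist x ?V)\<^sup>2) ^ N \<le> C * t" using growth h False by simp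
    then show ?thesis by (simp add: power_mult)
  qed
  then show ?thesis using N by blast
qed

section \<open>Hausdorff distance between sets of nearest points\<close>

lemma compact_nearest_points:
  assumes "closed X"
  shows "compact (nearest_points X x)"
proof -
  have "nearest_points X x = X \<inter> sphere x (infdist x X)"
    by (auto simp: nearest_points_def dist_norm norm_minus_commute)
  then show ?thesis using assms by (simp add: closed_Int_compact)
qed

lemma nearest_points_nonempty:
  assumes "closed X" "X \<noteq> {}"
  shows "nearest_points X x \<noteq> {}"
proof -
  obtain z where "z \<in> X" "infdist x X = dist x z"
    using infdist_attains_inf[OF assms] by blast
  then have "z \<in> nearest_points X x"
    by (simp add: nearest_points_def dist_norm norm_minus_commute)
  then show ?thesis by blast
qed

text \<open>Compactness bounds the set under the supremum; a real supremum of an unbounded set would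
  carry no information.\<close>

lemma infdist_le_hausdorff_dist:
  assumes "compact B" "b \<in> B"
  shows "infdist b A \<le> hausdorff_dist A B"
proof -
  have "compact ((\<lambda>y. infdist y A) ` B)"
    using assms(1) by (intro compact_continuous_image continuous_intros)
  then have "bdd_above ((\<lambda>y. infdist y A) ` B)"
    by (intro bounded_imp_bdd_above compact_imp_bounded)
  then have "infdist b A \<le> (SUP y\<in>B. infdist y A)"
    using assms(2) by (rule cSUP_upper[rotated])
  then show ?thesis by (simp add: hausdorff_dist_def)
qed

text \<open>Go from \<open>x\<close> to \<open>b\<close> through the point \<open>c\<close> of
  \<open>m(x)\<close> closest to \<open>b\<close>: the first leg is at most
  \<open>norm (x - z)\<close>, the second at most the Hausdorff distance.\<close>

lemma hausdorff_dist_nearest_points: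
  assumes X: "closed X" "X \<noteq> {}" and b: "b \<in> nearest_points X a" and z: "z \<in> X"
  shows "norm (x - b) \<le> norm (x - z) + hausdorff_dist (nearest_points X x) (nearest_points X a)"
proof -
  obtain c where c: "c \<in> nearest_points X x" "infdist b (nearest_points X x) = dist b c"
    by (rule infdist_attains_inf[OF compact_imp_closed[OF compact_nearest_points[OF X(1)]]
          nearest_points_nonempty[OF X]])
  have "norm (x - b) \<le> norm (x - c) + norm (c - b)"
    using norm_triangle_ineq[of "x - c" "c - b"] by simp
  moreover have "norm (x - c) \<le> norm (x - z)"
    using c(1) z by (metis nearest_points_iff[OF X] norm_minus_commute)
  moreover have "norm (c - b) \<le> hausdorff_dist (nearest_points X x) (nearest_points X a)"
    using infdist_le_hausdorff_dist[OF compact_nearest_points[OF X(1)] b] c(2)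
    by (metis dist_norm dist_commute)
  ultimately show ?thesis by linarith
qed

theorem mainTheorem10:
  fixes X K :: "(real ^ 'n) set" and a :: "real ^ 'n"
  assumes "X \<noteq> {}" and "closed X" and "semialgebraic X"
    and "compact K" and "a \<in> interior K"
  shows "\<exists>C \<alpha>. C > 0 \<and> \<alpha> > 0 \<and>
    (\<forall>x\<in>K. hausdorff_dist (nearest_points X x) (nearest_points X a)
       \<ge> C * infdist x {y. nearest_points X a \<subseteq> nearest_points X y} powr \<alpha>)"
proof -
  note X = \<open>closed X\<close> \<open>X \<noteq> {}\<close>
  define M where "M = nearest_points X a"
  define V where "V = voronoi M X"
  define h where "h x = hausdorff_dist (nearest_points X x) M" for x
  have V_eq: "{y. nearest_points X a \<subseteq> nearest_points X y} = V"
    unfolding V_def M_def by (rule voronoi_nearest_points[OF X])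
  obtain R where R: "R > 0" "\<And>x. x \<in> K \<Longrightarrow> norm (x - a) \<le> R"
  proof -
    have "bounded ((\<lambda>x. x - a) ` K)"
      using assms(4) by (intro compact_imp_bounded compact_continuous_image continuous_intros)
    then obtain R where "R > 0" "\<forall>y\<in>(\<lambda>x. x - a) ` K. norm y \<le> R"
      using bounded_pos by blast
    then show ?thesis by (intro that[of R]) auto
  qed
  have defX: "definable (\<lambda>e. e k \<in> X)" for k
    by (rule definable_semialgebraic[OF assms(3)])
  have defM: "definable (\<lambda>e. e k \<in> M)" for k
    unfolding M_def by (rule definable_nearest_points[OF X defX])
  obtain N C \<delta> where N: "N \<ge> 1" "C \<ge> 0" "\<delta> > 0"
    and growth: "\<And>x t. norm (x - a) \<le> R \<Longrightarrow> 0 < t \<Longrightarrow> t < \<delta> \<Longrightarrow>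
      (\<forall>b\<in>M. \<forall>z\<in>X. (norm (x - b))\<^sup>2 \<le> (norm (x - z))\<^sup>2 + t) \<Longrightarrow> infdist x V ^ (2 * N) \<le> C * t"
    using voronoi_growth[OF defM defX, of a R] unfolding V_def by blast
  \<comment> \<open>Bounds \<open>norm (x - b) + norm (x - z)\<close> when \<open>z\<close> is
    closer to \<open>x\<close> than \<open>b\<close> is, since \<open>norm (x - b)\<close> is at
    most \<open>R + infdist a X\<close>.\<close>
  define L where "L = 2 * (R + infdist a X)"
  have L: "L > 0" using R(1) infdist_nonneg[of a X] by (simp add: L_def)
  have defect: "(norm (x - b))\<^sup>2 \<le> (norm (x - z))\<^sup>2 + L * h x"
    if "x \<in> K" "b \<in> M" "z \<in> X" "0 \<le> h x" for x b z
  proof (cases "norm (x - b) \<le> norm (x - z)")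
    case True
    then have "(norm (x - b))\<^sup>2 \<le> (norm (x - z))\<^sup>2" by (intro power_mono) auto
    then show ?thesis using L that(4) by (smt (verit) mult_nonneg_nonneg)
  next
    case False
    have "norm (x - b) \<le> norm (x - z) + h x"
      unfolding h_def M_def using hausdorff_dist_nearest_points[OF X] that by (simp add: M_def)
    moreover have "norm (x - b) \<le> norm (x - a) + norm (a - b)"
      using norm_triangle_ineq[of "x - a" "a - b"] by simp
    moreover have "norm (a - b) = infdist a X"
      using that(2) by (simp add: M_def nearest_points_def norm_minus_commute)
    ultimately have *: "norm (x - b) - norm (x - z) \<le> h x" "norm (x - b) + norm (x - z) \<le> L"
      using R(2)[OF that(1)] False by (auto simp: L_def)
    have "(norm (x - b) - norm (x - z)) * (norm (x - b) + norm (x - z)) \<le> h x * L"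
      using * that(4) by (intro mult_mono) auto
    then show ?thesis by (simp add: power2_eq_square algebra_simps)
  qed
  have h0: "0 \<le> h x" for x
  proof -
    obtain b where "b \<in> M" using nearest_points_nonempty[OF X] M_def by blast
    then have "infdist b (nearest_points X x) \<le> h x"
      unfolding h_def M_def
      by (intro infdist_le_hausdorff_dist compact_nearest_points[OF X(1)])
    then show ?thesis using infdist_nonneg order_trans by blast
  qed
  \<comment> \<open>\<open>V\<close> is non-empty, so \<open>infdist\<close> is a genuine distance,
    and on \<open>K\<close> it is at most \<open>R\<close>.\<close>
  have aV: "a \<in> V" using V_eq by blast
  have inf_le: "infdist x V \<le> R" if "x \<in> K" for x
    using infdist_le[OF aV, of x] R(2)[OF that] by (simp add: dist_norm)
  \<comment> \<open>The first entry serves defects below \<open>\<delta>\<close>, where the growth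
    estimate applies; the second serves larger ones, where the distance to \<open>V\<close> is just
    bounded by \<open>R\<close>. \<open>C + 1\<close> avoids dividing by a vanishing
    \<open>C\<close>.\<close>
  define c where "c = min (1 / ((C + 1) * L)) (\<delta> / (L * R ^ (2 * N)))"
  have c: "c > 0" using N L R(1) by (simp add: c_def)
  have "c * infdist x V ^ (2 * N) \<le> h x" if x: "x \<in> K" for x
  proof -
    consider "h x = 0" | "0 < h x" "L * h x < \<delta>" | "\<delta> \<le> L * h x" using h0[of x] by force
    then show ?thesis
    proof cases
      \<comment> \<open>The growth estimate requires a positive defect, so this case is settled
        directly: the defect inequalities put \<open>x\<close> into \<open>V\<close>.\<close>
      case 1
      then have "x \<in> V"
        using defect[OF x] unfolding V_def voronoi_def by (simp add: power2_le_iff_abs_le)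
      then show ?thesis using 1 N by (simp add: infdist_zero power_0_left)
    next
      case 2
      then have "infdist x V ^ (2 * N) \<le> C * (L * h x)"
        using growth[OF R(2)[OF x], of "L * h x"] defect[OF x] L by simp
      also have "\<dots> \<le> (C + 1) * (L * h x)" using L 2 by (intro mult_right_mono) auto
      finally have "infdist x V ^ (2 * N) \<le> (C + 1) * L * h x" by (simp add: mult.assoc)
      then have "1 / ((C + 1) * L) * infdist x V ^ (2 * N) \<le> h x"
        using pos_divide_le_eq[of "(C + 1) * L"] N L by (simp add: mult.commute)
      moreover have "c * infdist x V ^ (2 * N) \<le> 1 / ((C + 1) * L) * infdist x V ^ (2 * N)"
        using infdist_nonneg[of x V] by (intro mult_right_mono) (auto simp: c_def)
      ultimately show ?thesis by linarith
    next
      case 3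
      have "c * infdist x V ^ (2 * N) \<le> \<delta> / (L * R ^ (2 * N)) * R ^ (2 * N)"
        using infdist_nonneg[of x V] inf_le[OF x] N L R(1)
        by (intro mult_mono power_mono) (auto simp: c_def)
      also have "\<dots> = \<delta> / L" using R(1) by simp
      also have "\<dots> \<le> h x" using 3 L by (simp add: field_simps)
      finally show ?thesis .
    qed
  qed
  \<comment> \<open>At distance 0 both sides are 0, the right one because \<open>N\<close> is
    positive.\<close>
  moreover have "infdist x V powr real (2 * N) = infdist x V ^ (2 * N)" for x
    using N(1) infdist_nonneg[of x V] powr_realpow[of "infdist x V" "2 * N"]
    by (cases "infdist x V = 0") (auto simp: power_0_left)
  ultimately have "\<forall>x\<in>K. h x \<ge> c * infdist x V powr real (2 * N)" by simp
  then show ?thesis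
    unfolding V_eq using c N(1) h_def M_def
    by (intro exI[of _ c] exI[of _ "real (2 * N)"]) simp
qed

end
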